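(* Let $A \in \mathbb{Z}^{m\times n}$ with $\operatorname{rank}(A)=m\ge 1$, $b\in\mathbb{Z}^m$, $c\in\mathbb{Z}^n$, and assume the integer program (IP) $\max\{c^\top z : Az=b,\ z\in\mathbb{Z}^n_{\ge 0}\}$ is feasible and bounded. Then for every optimal vertex solution $x^*$ of the linear relaxation (LP) $\max\{c^\top x : Ax=b,\ x\in\mathbb{R}^n_{\ge 0}\}$, there exists an optimal solution $z^*$ of (IP) such that \[ \|z^*-x^*\|_1 < 3m^2 \log\bigl(2\sqrt{m}\cdot \Delta^{1/m}\bigr)\cdot \Delta . \]
   Context: For $k\in\{1,\dots,m\}$, $\Delta_k(A)$ denotes the largest absolute value of the determinant of a $k\times k$ submatrix of $A$, and $\Delta:=\Delta_m(A)$. All logarithms $\log$ are base 2. *)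

theory Defs
  imports "HOL-Analysis.Analysis" "Jordan_Normal_Form.DL_Rank" "Jordan_Normal_Form.DL_Submatrix"
begin

definition Delta_k :: "int mat \<Rightarrow> nat \<Rightarrow> int" where
  "Delta_k A k = Max {\<bar>det (submatrix A I J)\<bar> | I J.
      I \<subseteq> {..<dim_row A} \<and> J \<subseteq> {..<dim_col A} \<and> card I = k \<and> card J = k}"

definition Delta :: "int mat \<Rightarrow> int" where
  "Delta A = Delta_k A (dim_row A)"

definition lp_feasible :: "int mat \<Rightarrow> int vec \<Rightarrow> real vec \<Rightarrow> bool" where
  "lp_feasible A b x \<longleftrightarrow> x \<in> carrier_vec (dim_col A) \<and>
     map_mat real_of_int A *\<^sub>v x = map_vec real_of_int b \<and> (\<forall>i<dim_col A. x $ i \<ge> 0)"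

definition ip_feasible :: "int mat \<Rightarrow> int vec \<Rightarrow> int vec \<Rightarrow> bool" where
  "ip_feasible A b z \<longleftrightarrow> z \<in> carrier_vec (dim_col A) \<and>
     A *\<^sub>v z = b \<and> (\<forall>i<dim_col A. z $ i \<ge> 0)"

definition lp_optimal :: "int mat \<Rightarrow> int vec \<Rightarrow> int vec \<Rightarrow> real vec \<Rightarrow> bool" where
  "lp_optimal A b c x \<longleftrightarrow> lp_feasible A b x \<and>
     (\<forall>y. lp_feasible A b y \<longrightarrow> map_vec real_of_int c \<bullet> y \<le> map_vec real_of_int c \<bullet> x)"

definition ip_optimal :: "int mat \<Rightarrow> int vec \<Rightarrow> int vec \<Rightarrow> int vec \<Rightarrow> bool" where
  "ip_optimal A b c z \<longleftrightarrow> ip_feasible A b z \<and>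
     (\<forall>w. ip_feasible A b w \<longrightarrow> c \<bullet> w \<le> c \<bullet> z)"

definition ip_bounded :: "int mat \<Rightarrow> int vec \<Rightarrow> int vec \<Rightarrow> bool" where
  "ip_bounded A b c \<longleftrightarrow> (\<exists>M. \<forall>z. ip_feasible A b z \<longrightarrow> c \<bullet> z \<le> M)"

definition lp_vertex :: "int mat \<Rightarrow> int vec \<Rightarrow> real vec \<Rightarrow> bool" where
  "lp_vertex A b x \<longleftrightarrow> lp_feasible A b x \<and>
     \<not> (\<exists>y w t. lp_feasible A b y \<and> lp_feasible A b w \<and> y \<noteq> w \<and> 0 < t \<and> t < 1 \<and>
            x = t \<cdot>\<^sub>v y + (1 - t) \<cdot>\<^sub>v w)"

definition l1_dist :: "int vec \<Rightarrow> real vec \<Rightarrow> real" where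
  "l1_dist z x = (\<Sum>i<dim_vec x. \<bar>real_of_int (z $ i) - x $ i\<bar>)"

end

theory Submission
  imports Defs
begin

text \<open>
  Let \<open>z\<close> be an integer optimum of minimal support \<open>S\<close>, and \<open>s = |S|\<close>. The \<open>2^s\<close> subset sums of the
  columns in \<open>S\<close> are pairwise distinct, since otherwise \<open>z\<close> could be moved along a kernel vector with
  entries in \<open>{-1, 0, 1}\<close> until its support shrinks. In the coordinates given by a submatrix \<open>B\<close> with
  \<open>|det B| = \<Delta>\<close> all columns have entries in \<open>[-1, 1]\<close>, so the subset sums have variance at most \<open>s/4\<close>
  in each coordinate, while they lie in at most \<open>\<Delta>\<close> cosets of the integer lattice. Summing a Gaussian
  weight over these cosets and applying Jensen's inequality yields \<open>2^s \<le> \<Delta> (2e(s + 1))^(m/2)\<close>, whence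
  \<open>s (m + 1) \<le> 3 m^2 log (2 sqrt m \<Delta>^(1/m))\<close>.

  The vector \<open>x* - z\<close> is a conformal nonnegative combination of at most \<open>s\<close> integral circuits, because
  the columns in the support of the vertex \<open>x*\<close> are independent. By Cramer's rule every circuit can be
  scaled to have \<open>l1\<close>-norm at most \<open>(m + 1) \<Delta>\<close>. Adding to \<open>z\<close> the combination with all coefficients
  rounded down gives a feasible point which is again optimal, as the opposite move is feasible from \<open>x*\<close>,
  and its distance to \<open>x*\<close> is less than \<open>s (m + 1) \<Delta>\<close>.
\<close>

section \<open>Gaussian sums and subset sums\<close>

text \<open>The function \<open>cosh y * exp (- y\<^sup>2 / 2)\<close> equals 1 at 0 and does not
  increase for positive \<open>y\<close>, since its derivative has the sign of
  \<open>sinh y - y * cosh y\<close>. Evenness covers negative arguments.\<close>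

lemma cosh_le_exp_half_square: "cosh (x::real) \<le> exp (x\<^sup>2 / 2)"
proof -
  have pos: "cosh y \<le> exp (y\<^sup>2 / 2)" if "y \<ge> 0" for y :: real
  proof -
    have tanh_le: "sinh z \<le> z * cosh z" if "z \<ge> 0" for z :: real
    proof -
      have "(\<lambda>z. z * cosh z - sinh z) 0 \<le> (\<lambda>z::real. z * cosh z - sinh z) z"
        by (rule DERIV_nonneg_imp_nondecreasing[OF that])
           (auto intro!: exI derivative_eq_intros)
      then show ?thesis by simp
    qed
    have "(\<lambda>y. - (cosh y * exp (- y\<^sup>2 / 2))) 0 \<le> (\<lambda>y::real. - (cosh y * exp (- y\<^sup>2 / 2))) y"
    proof (rule DERIV_nonneg_imp_nondecreasing[OF that])
      fix z :: real assume z: "0 \<le> z"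
      have "((\<lambda>y. - (cosh y * exp (- y\<^sup>2 / 2))) has_real_derivative
              (z * cosh z - sinh z) * exp (- z\<^sup>2 / 2)) (at z)"
        by (auto intro!: derivative_eq_intros simp: algebra_simps)
      then show "\<exists>d. ((\<lambda>y. - (cosh y * exp (- y\<^sup>2 / 2))) has_real_derivative d) (at z) \<and> 0 \<le> d"
        using tanh_le[OF z] by (intro exI conjI) auto
    qed
    then have "cosh y * exp (- y\<^sup>2 / 2) \<le> 1" by simp
    then show ?thesis by (simp add: exp_minus field_simps)
  qed
  show ?thesis using pos[of x] pos[of "-x"] by (cases "x \<ge> 0") auto
qed

lemma tanh_diff:
  fixes x y :: real
  shows "tanh x - tanh y = sinh (x - y) / (cosh x * cosh y)"
  by (simp add: tanh_def sinh_diff field_simps)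

lemma sinh_ge_self: "x \<ge> 0 \<Longrightarrow> x \<le> sinh (x::real)"
proof -
  assume "x \<ge> 0"
  then have "(\<lambda>z::real. sinh z - z) 0 \<le> (\<lambda>z. sinh z - z) x"
    by (rule DERIV_nonneg_imp_nondecreasing)
       (auto intro!: exI derivative_eq_intros simp: cosh_real_ge_1)
  then show ?thesis by simp
qed

text \<open>The Gaussian weight is dominated by an increment of a hyperbolic tangent, so that the sum
  over a translate of the integers telescopes.\<close>

lemma sum_gaussian_le:
  fixes K :: "int set" and l t :: real
  assumes K: "finite K" and l: "l > 0"
  shows "(\<Sum>k\<in>K. exp (- l * (of_int k + t)\<^sup>2)) \<le> 2 / sqrt l * exp (l / 4)"
proof -
  define r where "r = sqrt l"
  have r: "r > 0" "r\<^sup>2 = l" using l by (auto simp: r_def)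
  \<comment> \<open>The shift by 1/2 centres the increment \<open>T (k + 1) - T k\<close> at
    \<open>of_int k + t\<close>, so that the mixed terms of the two squares cancel and only the
    constant \<open>l / 4\<close> is left over.\<close>
  define T where "T = (\<lambda>k::int. tanh (r * (of_int k + t - 1/2)))"
  have step: "r * exp (- l / 4) * exp (- l * (of_int k + t)\<^sup>2) \<le> T (k + 1) - T k" for k
  proof -
    define v where "v = of_int k + t"
    have "T (k + 1) - T k = sinh r / (cosh (r * (v + 1/2)) * cosh (r * (v - 1/2)))"
      unfolding T_def tanh_diff by (simp add: v_def algebra_simps)
    moreover have "cosh (r * (v + 1/2)) * cosh (r * (v - 1/2)) \<le>
        exp ((r * (v + 1/2))\<^sup>2 / 2) * exp ((r * (v - 1/2))\<^sup>2 / 2)"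
      by (intro mult_mono cosh_le_exp_half_square) auto
    moreover have "\<dots> = exp (l * v\<^sup>2 + l / 4)"
      unfolding exp_add[symmetric] r(2)[symmetric] by (simp add: field_simps power2_eq_square)
    moreover have "r \<le> sinh r" using r by (intro sinh_ge_self) auto
    ultimately have "T (k + 1) - T k \<ge> r / exp (l * v\<^sup>2 + l / 4)"
      using r by (auto intro!: frac_le)
    moreover have "r * exp (- l / 4) * exp (- l * v\<^sup>2) = r / exp (l * v\<^sup>2 + l / 4)"
    proof -
      have "- l / 4 + - l * v\<^sup>2 = - (l * v\<^sup>2 + l / 4)" by simp
      then show ?thesis
        by (metis (no_types) divide_inverse exp_add exp_minus mult.assoc)
    qed
    ultimately show ?thesis by (simp add: v_def)
  qed
  have Tlt: "\<bar>T k\<bar> \<le> 1" for k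
    using tanh_real_lt_1[of "r * (of_int k + t - 1/2)"] tanh_real_gt_neg1[of "r * (of_int k + t - 1/2)"]
    by (simp add: T_def abs_le_iff)
  obtain N :: nat where N: "K \<subseteq> {- int N..<int N}"
  proof -
    obtain M where M: "\<And>k. k \<in> K \<Longrightarrow> \<bar>k\<bar> \<le> M"
      using K by (metis finite_imageI Max_ge imageI)
    show ?thesis by (rule that[of "nat M + 1"]) (use M in force)
  qed
  have tele: "(\<Sum>k\<in>{a..<a + int n}. T (k + 1) - T k) = T (a + int n) - T a" for a n
  proof (induction n)
    case (Suc n)
    have "{a..<a + int (Suc n)} = insert (a + int n) {a..<a + int n}" by auto
    then show ?case using Suc by (simp add: algebra_simps)
  qed simp
  have "r * exp (- l / 4) * (\<Sum>k\<in>K. exp (- l * (of_int k + t)\<^sup>2)) \<le> (\<Sum>k\<in>K. T (k + 1) - T k)"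
    unfolding sum_distrib_left by (rule sum_mono) (rule step)
  also have "\<dots> \<le> (\<Sum>k\<in>{- int N..<int N}. T (k + 1) - T k)"
  proof (rule sum_mono2)
    fix k show "0 \<le> T (k + 1) - T k"
      by (rule order_trans[OF _ step]) (use r in simp)
  qed (use N in auto)
  also have "\<dots> = T (int N) - T (- int N)"
    using tele[of "- int N" "2 * N"] by simp
  also have "\<dots> \<le> 2" using Tlt[of "int N"] Tlt[of "- int N"] by linarith
  finally show ?thesis
    unfolding r_def using l by (simp add: exp_minus field_simps)
qed

text \<open>For a uniformly random \<open>X\<close> the signs are independent with mean 0, so the
  variances \<open>(h j)\<^sup>2 / 4\<close> add up. The induction pairs \<open>X\<close> with
  \<open>insert a X\<close>, and the cross terms of each pair cancel.\<close>

lemma sum_Pow_signed_sum_square: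
  fixes h :: "'a \<Rightarrow> real"
  assumes "finite S"
  shows "(\<Sum>X\<in>Pow S. (\<Sum>j\<in>S. (if j \<in> X then 1/2 else -1/2) * h j)\<^sup>2)
           = 2 ^ card S * (\<Sum>j\<in>S. (h j)\<^sup>2) / 4"
  using assms
proof (induction S rule: finite_induct)
  case (insert a S)
  define D where "D = (\<lambda>X. \<Sum>j\<in>S. (if j \<in> X then 1/2 else -1/2) * h j)"
  have inj: "inj_on (insert a) (Pow S)" using insert.hyps by (auto simp: inj_on_def)
  have disj: "Pow S \<inter> insert a ` Pow S = {}" using insert.hyps by auto
  have D_insert: "D (insert a X) = D X" for X
    unfolding D_def using insert.hyps by (intro sum.cong) auto
  have "(\<Sum>X\<in>Pow (insert a S). (\<Sum>j\<in>insert a S. (if j \<in> X then 1/2 else -1/2) * h j)\<^sup>2)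
      = (\<Sum>X\<in>Pow (insert a S). ((if a \<in> X then 1/2 else -1/2) * h a + D X)\<^sup>2)"
    using insert.hyps by (simp add: D_def)
  also have "\<dots> = (\<Sum>X\<in>Pow S. (- h a / 2 + D X)\<^sup>2) + (\<Sum>X\<in>Pow S. (h a / 2 + D X)\<^sup>2)"
    unfolding Pow_insert using insert.hyps inj disj
    by (subst sum.union_disjoint)
       (auto simp: sum.reindex D_insert intro!: sum.cong arg_cong2[where f = "(+)"])
  also have "\<dots> = (\<Sum>X\<in>Pow S. 2 * (D X)\<^sup>2 + (h a)\<^sup>2 / 2)"
    unfolding sum.distrib[symmetric] by (intro sum.cong) (auto simp: power2_eq_square field_simps)
  also have "\<dots> = 2 * (\<Sum>X\<in>Pow S. (D X)\<^sup>2) + 2 ^ card S * (h a)\<^sup>2 / 2"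
    using insert.hyps by (simp add: sum.distrib sum_distrib_left card_Pow)
  finally show ?case using insert by (simp add: D_def field_simps)
qed simp

text \<open>Jensen's inequality for the convex decreasing function exp(-x): its tangent at
  \<open>q\<close> lies below the graph, and the tangent values are summed.\<close>

lemma jensen_exp_sum:
  fixes Q :: "'a \<Rightarrow> real"
  assumes "finite P" and "(\<Sum>x\<in>P. Q x) \<le> real (card P) * q"
  shows "real (card P) * exp (- q) \<le> (\<Sum>x\<in>P. exp (- Q x))"
proof -
  have "exp (- q) * (1 + (q - Q x)) \<le> exp (- Q x)" for x
    using mult_left_mono[OF exp_ge_add_one_self[of "q - Q x"], of "exp (-q)"]
    by (simp flip: exp_add)
  then have "(\<Sum>x\<in>P. exp (- q) * (1 + (q - Q x))) \<le> (\<Sum>x\<in>P. exp (- Q x))"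
    by (rule sum_mono)
  moreover have "(\<Sum>x\<in>P. exp (- q) * (1 + (q - Q x)))
      = exp (- q) * (real (card P) + (real (card P) * q - (\<Sum>x\<in>P. Q x)))"
    using assms(1) by (simp add: sum_distrib_left[symmetric] sum.distrib sum_subtractf)
  moreover have "\<dots> \<ge> exp (- q) * real (card P)"
    using assms(2) by (intro mult_left_mono) auto
  ultimately have "exp (- q) * real (card P) \<le> (\<Sum>x\<in>P. exp (- Q x))" by linarith
  then show ?thesis by (simp only: mult.commute)
qed

section \<open>Lattice cosets\<close>

text \<open>Working with entry functions leaves the dimension free for inductions and turns the
  replacement of a column of a minor into a function update.\<close>

definition fdet :: "nat \<Rightarrow> (nat \<Rightarrow> nat \<Rightarrow> 'a::comm_ring_1) \<Rightarrow> 'a" where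
  "fdet m b = det (Matrix.mat m m (\<lambda>(i, k). b i k))"

lemma fdet_cong:
  "(\<And>i k. i < m \<Longrightarrow> k < m \<Longrightarrow> b i k = b' i k) \<Longrightarrow> fdet m b = fdet m b'"
  unfolding fdet_def by (intro arg_cong[where f = det] cong_mat) auto

lemma fdet_of_int: "fdet m (\<lambda>i k. real_of_int (b i k)) = real_of_int (fdet m b)"
proof -
  have "Matrix.mat m m (\<lambda>(i, k). real_of_int (b i k)) =
      map_mat real_of_int (Matrix.mat m m (\<lambda>(i, k). b i k))"
    by (intro eq_matI) auto
  then show ?thesis unfolding fdet_def by (simp add: of_int_hom.hom_det)
qed

lemma fdet_addcol:
  assumes "j < m" "l < m" "j \<noteq> l"
  shows "fdet m (\<lambda>i k. if k = j then b i j + c * b i l else b i k) = fdet m b"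
proof -
  have "Matrix.mat m m (\<lambda>(i, k). if k = j then b i j + c * b i l else b i k) =
      addcol c j l (Matrix.mat m m (\<lambda>(i, k). b i k))"
    using assms by (intro eq_matI) auto
  then show ?thesis unfolding fdet_def using assms det_addcol[of l m j] by simp
qed

lemma fdet_expand_row_0:
  "fdet (Suc m) b =
     (\<Sum>j<Suc m. b 0 j * ((-1) ^ j * fdet m (\<lambda>i k. b (Suc i) (insert_index j k))))"
proof -
  let ?B = "Matrix.mat (Suc m) (Suc m) (\<lambda>(i, k). b i k)"
  have "det ?B = (\<Sum>j<Suc m. ?B $$ (0, j) * cofactor ?B 0 j)"
    by (rule laplace_expansion_row) auto
  also have "\<dots> = (\<Sum>j<Suc m. b 0 j * ((-1) ^ j * fdet m (\<lambda>i k. b (Suc i) (insert_index j k))))"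
  proof (rule sum.cong[OF refl])
    fix j assume "j \<in> {..<Suc m}"
    then have "mat_delete ?B 0 j = Matrix.mat m m (\<lambda>(i, k). b (Suc i) (insert_index j k))"
      unfolding mat_delete_def by (intro eq_matI) (auto simp: insert_index_def)
    then show "?B $$ (0, j) * cofactor ?B 0 j =
        b 0 j * ((-1) ^ j * fdet m (\<lambda>i k. b (Suc i) (insert_index j k)))"
      using \<open>j \<in> _\<close> by (simp add: cofactor_def fdet_def)
  qed
  finally show ?thesis by (simp only: fdet_def)
qed

lemma fdet_nonzero_kernel:
  fixes b :: "nat \<Rightarrow> nat \<Rightarrow> real"
  assumes nz: "fdet m b \<noteq> 0" and 0: "\<And>i. i < m \<Longrightarrow> (\<Sum>k<m. b i k * v k) = 0" and k: "k < m"
  shows "v k = 0"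
proof (rule ccontr)
  assume "v k \<noteq> 0"
  let ?B = "Matrix.mat m m (\<lambda>(i, k). b i k)" and ?v = "Matrix.vec m v"
  have "?v \<noteq> 0\<^sub>v m"
  proof
    assume "?v = 0\<^sub>v m"
    then have "?v $ k = 0\<^sub>v m $ k" by simp
    then show False using k \<open>v k \<noteq> 0\<close> by simp
  qed
  moreover have "?B *\<^sub>v ?v = 0\<^sub>v m"
    using 0 by (intro eq_vecI) (auto simp: scalar_prod_def lessThan_atLeast0)
  ultimately have "det ?B = 0"
    using det_0_iff_vec_prod_zero_field[of ?B m] by (metis mat_carrier vec_carrier)
  then show False using nz by (simp add: fdet_def)
qed

lemma sum_insert_index:
  fixes f :: "nat \<Rightarrow> 'a::ab_group_add"
  assumes "j < Suc m"
  shows "(\<Sum>k<Suc m. f k) = f j + (\<Sum>k<m. f (insert_index j k))"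
proof -
  have "(\<Sum>k<m. f (insert_index j k)) = (\<Sum>k\<in>insert_index j ` {0..<m}. f k)"
    by (subst sum.reindex[OF insert_index_inj_on]) (simp add: lessThan_atLeast0)
  also have "insert_index j ` {0..<m} = {..<Suc m} - {j}"
    using insert_index_image[OF assms] by (simp add: lessThan_atLeast0)
  finally show ?thesis using assms by (simp add: sum_diff1)
qed

text \<open>Column operations perform the Euclidean algorithm on the first row until a single nonzero
  entry is left, which can then be split off.\<close>

lemma lattice_coset_representatives:
  fixes b :: "nat \<Rightarrow> nat \<Rightarrow> int"
  assumes "fdet m b \<noteq> 0"
  shows "\<exists>R. finite R \<and> int (card R) \<le> \<bar>fdet m b\<bar> \<and>
     (\<forall>p. \<exists>r\<in>R. \<exists>y. \<forall>i<m. p i = (\<Sum>k<m. b i k * y k) + r i)"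
  using assms
proof (induction m arbitrary: b)
  case 0
  show ?case by (intro exI[of _ "{\<lambda>_. 0}"]) (auto simp: fdet_def)
next
  case (Suc m)
  show ?case using Suc.prems
  \<comment> \<open>The inner induction is on the l1-norm of the first row, which every column
    operation lowers.\<close>
  proof (induction "\<Sum>k<Suc m. nat \<bar>b 0 k\<bar>" arbitrary: b rule: less_induct)
    case less
    have "\<exists>j<Suc m. b 0 j \<noteq> 0"
    proof (rule ccontr)
      assume "\<not> ?thesis"
      then have "fdet (Suc m) b = 0" unfolding fdet_expand_row_0 by (intro sum.neutral) auto
      then show False using less.prems by simp
    qed
    then obtain j0 where j0: "j0 < Suc m" "b 0 j0 \<noteq> 0" by blast
    show ?case
    proof (cases "\<exists>l<Suc m. l \<noteq> j0 \<and> b 0 l \<noteq> 0")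
      case True
      then obtain l0 where l0: "l0 < Suc m" "l0 \<noteq> j0" "b 0 l0 \<noteq> 0" by blast
      obtain j l where jl: "j < Suc m" "l < Suc m" "j \<noteq> l" "b 0 l \<noteq> 0" "\<bar>b 0 l\<bar> \<le> \<bar>b 0 j\<bar>"
        using j0 l0 by (cases "\<bar>b 0 l0\<bar> \<le> \<bar>b 0 j0\<bar>") (auto dest: less_imp_le simp: not_le)
      \<comment> \<open>With this sign the entry \<open>b 0 j\<close> loses exactly
        \<open>\<bar>b 0 l\<bar>\<close> in absolute value.\<close>
      define c where "c = - (sgn (b 0 j) * sgn (b 0 l))"
      define b' where "b' = (\<lambda>i k. if k = j then b i j + c * b i l else b i k)"
      have b0j: "\<bar>b' 0 j\<bar> < \<bar>b 0 j\<bar>"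
        using jl by (auto simp: b'_def c_def sgn_if abs_if split: if_splits)
      have "(\<Sum>k<Suc m. nat \<bar>b' 0 k\<bar>) < (\<Sum>k<Suc m. nat \<bar>b 0 k\<bar>)"
        by (rule sum_strict_mono_ex1) (use jl b0j in \<open>auto simp: b'_def\<close>)
      moreover have det: "fdet (Suc m) b' = fdet (Suc m) b"
        unfolding b'_def using jl by (intro fdet_addcol) auto
      ultimately obtain R where R: "finite R" "int (card R) \<le> \<bar>fdet (Suc m) b\<bar>"
        and rep: "\<And>p. \<exists>r\<in>R. \<exists>y. \<forall>i<Suc m. p i = (\<Sum>k<Suc m. b' i k * y k) + r i"
        using less.hyps[of b'] less.prems by metis
      \<comment> \<open>A combination of the new columns is a combination of the old ones with the
        coefficient of column \<open>l\<close> corrected, so the representatives carry over.\<close>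
      have trans: "(\<Sum>k<Suc m. b' i k * y k) = (\<Sum>k<Suc m. b i k * (y(l := y l + c * y j)) k)" for i y
      proof -
        have "(\<Sum>k<Suc m. b' i k * y k) =
            (\<Sum>k<Suc m. b i k * y k + (if k = j then c * b i l * y j else 0))"
          by (intro sum.cong) (auto simp: b'_def algebra_simps)
        moreover have "(\<Sum>k<Suc m. b i k * (y(l := y l + c * y j)) k) =
            (\<Sum>k<Suc m. b i k * y k + (if k = l then c * b i l * y j else 0))"
          by (intro sum.cong) (auto simp: algebra_simps)
        ultimately show ?thesis using jl by (simp add: sum.distrib del: sum.lessThan_Suc)
      qed
      have "\<exists>r\<in>R. \<exists>y. \<forall>i<Suc m. p i = (\<Sum>k<Suc m. b i k * y k) + r i" for p
      proof -
        obtain r y where "r \<in> R" "\<forall>i<Suc m. p i = (\<Sum>k<Suc m. b' i k * y k) + r i"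
          using rep[of p] by blast
        then show ?thesis unfolding trans by blast
      qed
      then show ?thesis using R by blast
    next
      case False
      define d where "d = b 0 j0"
      define b' where "b' = (\<lambda>i k. b (Suc i) (insert_index j0 k))"
      have z: "b 0 (insert_index j0 k) = 0" if "k < m" for k
        using False that insert_index_exclude[of j0 k]
        by (metis Suc_less_eq insert_index_def less_Suc_eq)
      have det: "fdet (Suc m) b = d * ((-1) ^ j0 * fdet m b')"
        unfolding fdet_expand_row_0 sum_insert_index[OF j0(1)] using z
        by (simp add: d_def b'_def)
      have abs_det: "\<bar>fdet (Suc m) b\<bar> = \<bar>d\<bar> * \<bar>fdet m b'\<bar>"
        by (simp add: det abs_mult power_abs)
      have "fdet m b' \<noteq> 0" using less.prems det by auto
      then obtain R where R: "finite R" "int (card R) \<le> \<bar>fdet m b'\<bar>"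
        and rep: "\<And>p. \<exists>r\<in>R. \<exists>y. \<forall>i<m. p i = (\<Sum>k<m. b' i k * y k) + r i"
        using Suc.IH[of b'] by blast
      \<comment> \<open>The first row now involves column \<open>j0\<close> only. The first
        coordinate is therefore reduced modulo \<open>\<bar>d\<bar>\<close> and the others by the
        induction hypothesis; the counts multiply just as the determinant does.\<close>
      define R' where "R' = (\<lambda>(r0, r). case_nat r0 r) ` ({0..<\<bar>d\<bar>} \<times> R)"
      have "card R' \<le> nat \<bar>d\<bar> * card R"
        unfolding R'_def using card_image_le[of "{0..<\<bar>d\<bar>} \<times> R"] R(1)
        by (auto simp: card_cartesian_product)
      then have "int (card R') \<le> int (nat \<bar>d\<bar> * card R)" by (simp only: of_nat_le_iff)
      then have "int (card R') \<le> \<bar>d\<bar> * int (card R)" by simp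
      also have "\<dots> \<le> \<bar>d\<bar> * \<bar>fdet m b'\<bar>" using R(2) by (intro mult_left_mono) auto
      finally have card: "int (card R') \<le> \<bar>fdet (Suc m) b\<bar>" by (simp add: abs_det)
      have "\<exists>r\<in>R'. \<exists>y. \<forall>i<Suc m. p i = (\<Sum>k<Suc m. b i k * y k) + r i" for p
      proof -
        define q where "q = sgn d * (p 0 div \<bar>d\<bar>)"
        define r0 where "r0 = p 0 mod \<bar>d\<bar>"
        have p0: "p 0 = d * q + r0"
        proof -
          have "d * q = \<bar>d\<bar> * (p 0 div \<bar>d\<bar>)" by (simp add: q_def abs_sgn mult.assoc[symmetric])
          then show ?thesis by (simp add: r0_def)
        qed
        have r0: "r0 \<in> {0..<\<bar>d\<bar>}" using j0 by (simp add: r0_def d_def)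
        obtain r y where r: "r \<in> R"
          and y: "\<And>i. i < m \<Longrightarrow> p (Suc i) - b (Suc i) j0 * q = (\<Sum>k<m. b' i k * y k) + r i"
          using rep[of "\<lambda>i. p (Suc i) - b (Suc i) j0 * q"] by metis
        define y' where "y' = (\<lambda>k. if k = j0 then q else y (delete_index j0 k))"
        have y': "y' (insert_index j0 k) = y k" "y' j0 = q" for k
          using insert_index_exclude[of j0 k] by (auto simp: y'_def)
        have "p i = (\<Sum>k<Suc m. b i k * y' k) + case_nat r0 r i" if "i < Suc m" for i
        proof (cases i)
          case 0
          then show ?thesis unfolding sum_insert_index[OF j0(1)] y'
            using p0 z by (simp add: d_def)
        next
          case (Suc i')
          then show ?thesis unfolding sum_insert_index[OF j0(1)] y'
            using y[of i'] that by (simp add: b'_def)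
        qed
        moreover have "case_nat r0 r \<in> R'" unfolding R'_def using r0 r by force
        ultimately show ?thesis by blast
      qed
      moreover have "finite R'" using R(1) by (simp add: R'_def)
      ultimately show ?thesis using card by blast
    qed
  qed
qed

text \<open>The points \<open>p x\<close> fall into at most \<open>\<bar>fdet m b\<bar>\<close>
  cosets of the lattice spanned by the columns of \<open>b\<close>. Inside one coset the coordinate
  vectors \<open>w x\<close> are distinct integer vectors moved by a common shift. Enlarging them to
  a full grid makes the sum of products a product of one-dimensional sums, each at most
  \<open>C\<close>.\<close>

lemma sum_lattice_weights_le:
  fixes b :: "nat \<Rightarrow> nat \<Rightarrow> int" and p :: "'x \<Rightarrow> nat \<Rightarrow> int" and w :: "'x \<Rightarrow> nat \<Rightarrow> real"
  assumes det: "fdet m b \<noteq> 0" and fin: "finite P"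
    and w: "\<And>x i. x \<in> P \<Longrightarrow> i < m \<Longrightarrow> (\<Sum>k<m. of_int (b i k) * w x k) = of_int (p x i)"
    and inj: "\<And>x x'. x \<in> P \<Longrightarrow> x' \<in> P \<Longrightarrow> (\<And>i. i < m \<Longrightarrow> p x i = p x' i) \<Longrightarrow> x = x'"
    and g: "\<And>t. g t \<ge> 0"
    and C: "\<And>K t. finite K \<Longrightarrow> (\<Sum>k\<in>K. g (of_int k + t)) \<le> C"
  shows "(\<Sum>x\<in>P. \<Prod>i<m. g (w x i + \<mu> i)) \<le> real_of_int \<bar>fdet m b\<bar> * C ^ m"
proof -
  have C0: "C \<ge> 0" using C[of "{}" 0] by simp
  obtain R where R: "finite R" "int (card R) \<le> \<bar>fdet m b\<bar>"
    and rep: "\<And>q. \<exists>r\<in>R. \<exists>y. \<forall>i<m. q i = (\<Sum>k<m. b i k * y k) + r i"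
    using lattice_coset_representatives[OF det] by blast
  obtain r y where r: "\<And>x. r x \<in> R"
    and y: "\<And>x i. i < m \<Longrightarrow> p x i = (\<Sum>k<m. b i k * y x k) + r x i"
    using rep[of "p _"] by metis
  define F where "F = (\<lambda>x. \<Prod>i<m. g (w x i + \<mu> i))"
  have class_le: "(\<Sum>x\<in>{x \<in> P. r x = \<rho>}. F x) \<le> C ^ m" for \<rho>
  proof (cases "{x \<in> P. r x = \<rho>} = {}")
    case True
    then show ?thesis using C0 by (simp only: sum.empty zero_le_power)
  next
    case False
    then obtain x0 where x0: "x0 \<in> P" "r x0 = \<rho>" by blast
    let ?Q = "{x \<in> P. r x = \<rho>}"
    define \<tau> where "\<tau> = (\<lambda>k. w x0 k - of_int (y x0 k))"
    have wy: "w x k = of_int (y x k) + \<tau> k" if x: "x \<in> ?Q" and k: "k < m" for x k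
    proof -
      have "(\<Sum>k<m. of_int (b i k) * (w x k - of_int (y x k) - \<tau> k)) = 0" if "i < m" for i
      proof -
        have "(\<Sum>k<m. of_int (b i k) * (w x k - of_int (y x k) - \<tau> k)) =
          (\<Sum>k<m. of_int (b i k) * w x k) - of_int (\<Sum>k<m. b i k * y x k) -
          ((\<Sum>k<m. of_int (b i k) * w x0 k) - of_int (\<Sum>k<m. b i k * y x0 k))"
          unfolding \<tau>_def by (simp add: algebra_simps sum.distrib sum_subtractf)
        also have "\<dots> = 0"
          using w[of x i] w[of x0 i] x x0 that y[of i x] y[of i x0] by auto
        finally show ?thesis .
      qed
      then have "w x k - of_int (y x k) - \<tau> k = 0"
        using fdet_nonzero_kernel[of m "\<lambda>i k. of_int (b i k)" "\<lambda>k. w x k - of_int (y x k) - \<tau> k" k]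
          det k by (simp add: fdet_of_int)
      then show ?thesis by simp
    qed
    \<comment> \<open>Restriction makes the integer vectors extensional, hence elements of the
      product set over which sums of products factor.\<close>
    define \<eta> where "\<eta> = (\<lambda>x. restrict (y x) {..<m})"
    define K where "K = (\<lambda>i. (\<lambda>x. y x i) ` ?Q)"
    have finK: "finite (K i)" for i using fin by (simp add: K_def)
    have inj_\<eta>: "inj_on \<eta> ?Q"
    proof (rule inj_onI)
      fix x x' assume x: "x \<in> ?Q" "x' \<in> ?Q" and eq: "\<eta> x = \<eta> x'"
      have "y x k = y x' k" if "k < m" for k
        using fun_cong[OF eq, of k] that by (simp add: \<eta>_def)
      then have "p x i = p x' i" if "i < m" for i
        using x that y[of i x] y[of i x'] by simp
      then show "x = x'" using inj x by blast
    qed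
    have "(\<Sum>x\<in>?Q. F x) = (\<Sum>x\<in>?Q. \<Prod>i<m. g (of_int (\<eta> x i) + (\<tau> i + \<mu> i)))"
      unfolding F_def by (intro sum.cong prod.cong) (auto simp: wy \<eta>_def add.assoc)
    also have "\<dots> = (\<Sum>f\<in>\<eta> ` ?Q. \<Prod>i<m. g (of_int (f i) + (\<tau> i + \<mu> i)))"
      by (simp add: sum.reindex[OF inj_\<eta>])
    also have "\<dots> \<le> (\<Sum>f\<in>Pi\<^sub>E {..<m} K. \<Prod>i<m. g (of_int (f i) + (\<tau> i + \<mu> i)))"
      using finK g by (intro sum_mono2 finite_PiE prod_nonneg) (auto simp: \<eta>_def K_def split: if_splits)
    also have "\<dots> = (\<Prod>i<m. \<Sum>k\<in>K i. g (of_int k + (\<tau> i + \<mu> i)))"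
      using finK by (subst prod_sum_PiE) auto
    also have "\<dots> \<le> (\<Prod>i<m. C)"
      using C[OF finK] g by (intro prod_mono) (auto intro: sum_nonneg)
    finally show ?thesis by simp
  qed
  have "(\<Sum>x\<in>P. F x) = (\<Sum>\<rho>\<in>R. \<Sum>x\<in>{x \<in> P. r x = \<rho>}. F x)"
    by (rule sum.group[symmetric, OF fin R(1)]) (use r in blast)
  also have "\<dots> \<le> (\<Sum>\<rho>\<in>R. C ^ m)" by (intro sum_mono class_le)
  also have "\<dots> = real_of_int (int (card R)) * C ^ m" by simp
  also have "\<dots> \<le> real_of_int \<bar>fdet m b\<bar> * C ^ m"
    using R(2) C0 by (intro mult_right_mono) (simp_all only: of_int_le_iff zero_le_power)
  finally show ?thesis by (simp only: F_def)
qed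

section \<open>Maximal minors\<close>

definition minor :: "nat \<Rightarrow> (nat \<Rightarrow> nat \<Rightarrow> 'a::comm_ring_1) \<Rightarrow> (nat \<Rightarrow> nat) \<Rightarrow> 'a" where
  "minor m a f = fdet m (\<lambda>i k. a i (f k))"

text \<open>Cramer's rule without division: expansion along the replaced column yields cofactors of
  the original matrix \<open>B\<close>, and the resulting double sum collapses because
  \<open>B\<close> times its adjugate is \<open>det B\<close> times the identity.\<close>

lemma minor_cramer:
  assumes r: "r < m"
  shows "(\<Sum>i<m. minor m a (f(i := j)) * a r (f i)) = minor m a f * a r j"
proof -
  let ?B = "Matrix.mat m m (\<lambda>(i, k). a i (f k))"
  have B: "?B \<in> carrier_mat m m" by simp
  have replaced: "minor m a (f(i := j)) = (\<Sum>q<m. a q j * cofactor ?B q i)" if i: "i < m" for i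
  proof -
    let ?C = "Matrix.mat m m (\<lambda>(q, k). a q ((f(i := j)) k))"
    have "det ?C = (\<Sum>q<m. ?C $$ (q, i) * cofactor ?C q i)"
      by (rule laplace_expansion_column) (use i in auto)
    moreover have "mat_delete ?C q i = mat_delete ?B q i" if "q < m" for q
      unfolding mat_delete_def using i that by (intro eq_matI) auto
    ultimately show ?thesis using i by (simp add: minor_def fdet_def cofactor_def)
  qed
  have adj: "(\<Sum>i<m. a r (f i) * cofactor ?B q i) = (if q = r then minor m a f else 0)"
    if q: "q < m" for q
  proof -
    have "(?B * adj_mat ?B) $$ (r, q) = (\<Sum>i<m. a r (f i) * cofactor ?B q i)"
      using r q by (simp add: adj_mat_def scalar_prod_def lessThan_atLeast0)
    moreover have "(?B * adj_mat ?B) $$ (r, q) = (if q = r then minor m a f else 0)"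
      unfolding adj_mat(2)[OF B] using r q by (auto simp: minor_def fdet_def)
    ultimately show ?thesis by simp
  qed
  have "(\<Sum>i<m. minor m a (f(i := j)) * a r (f i)) =
      (\<Sum>i<m. \<Sum>q<m. a q j * (a r (f i) * cofactor ?B q i))"
    by (intro sum.cong) (auto simp: replaced sum_distrib_left sum_distrib_right mult_ac)
  also have "\<dots> = (\<Sum>q<m. \<Sum>i<m. a q j * (a r (f i) * cofactor ?B q i))"
    by (rule sum.swap)
  also have "\<dots> = (\<Sum>q<m. a q j * (if q = r then minor m a f else 0))"
    by (intro sum.cong) (auto simp: adj sum_distrib_left[symmetric])
  also have "\<dots> = (\<Sum>q<m. if q = r then a r j * minor m a f else 0)"
    by (intro sum.cong) auto
  finally show ?thesis using r by (simp add: mult.commute)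
qed

lemma minor_eq_0:
  assumes "\<not> inj_on f {..<m}"
  shows "minor m a f = 0"
proof -
  obtain k l where kl: "k < m" "l < m" "k \<noteq> l" "f k = f l"
    using assms by (auto simp: inj_on_def)
  have "col (Matrix.mat m m (\<lambda>(i, k). a i (f k))) k = col (Matrix.mat m m (\<lambda>(i, k). a i (f k))) l"
    using kl by (intro eq_vecI) auto
  then show ?thesis
    unfolding minor_def fdet_def using kl by (intro det_identical_columns[of _ m k l]) auto
qed

lemma abs_minor_permute:
  fixes a :: "nat \<Rightarrow> nat \<Rightarrow> int"
  assumes p: "p permutes {0..<m}"
  shows "\<bar>minor m a (\<lambda>k. f (p k))\<bar> = \<bar>minor m a f\<bar>"
proof -
  let ?B = "Matrix.mat m m (\<lambda>(i, k). a i (f k))"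
  have lt: "p k < m" if "k < m" for k using permutes_in_image[OF p] that by auto
  have "(Matrix.mat m m (\<lambda>(i, k). a i (f (p k))))\<^sup>T =
      Matrix.mat m m (\<lambda>(k, i). ?B\<^sup>T $$ (p k, i))"
    using lt by (intro eq_matI) auto
  then have "det (Matrix.mat m m (\<lambda>(i, k). a i (f (p k)))) =
      det (Matrix.mat m m (\<lambda>(k, i). ?B\<^sup>T $$ (p k, i)))"
    by (metis det_transpose mat_carrier)
  also have "\<dots> = signof p * det (?B\<^sup>T)"
    using p by (intro det_permute_rows) auto
  also have "det (?B\<^sup>T) = det ?B" by (rule det_transpose[of _ m]) simp
  finally show ?thesis by (simp add: minor_def fdet_def abs_mult sign_def)
qed

lemma det_submatrix_eq_minor:
  assumes A: "A \<in> carrier_mat m n" and J: "J \<subseteq> {..<n}" "card J = m"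
  shows "det (submatrix A {..<m} J) = minor m (\<lambda>i j. A $$ (i, j)) (pick J)"
proof -
  have "{j. j < dim_col A \<and> j \<in> J} = J" "{i. i < dim_row A \<and> i \<in> {..<m}} = {..<m}"
    using A J by auto
  moreover have "pick {..<m} i = i" if "i < m" for i
  proof -
    have "card {x \<in> {..<m}. x < i} = i"
      using that by (metis (no_types, lifting) Collect_cong card_lessThan lessThan_def lessThan_iff mem_Collect_eq order_less_trans)
    then show ?thesis using pick_card_in_set[of i "{..<m}"] that by simp
  qed
  ultimately show ?thesis unfolding submatrix_def minor_def fdet_def using J
    by (intro arg_cong[where f = det] eq_matI) auto
qed

text \<open>The only set of \<open>m\<close> row indices is the set of all rows, so the maximum runs
  over column sets alone.\<close>

lemma Delta_eq_Max:
  assumes A: "A \<in> carrier_mat m n"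
  shows "Delta A = Max ((\<lambda>J. \<bar>minor m (\<lambda>i j. A $$ (i, j)) (pick J)\<bar>) ` {J. J \<subseteq> {..<n} \<and> card J = m})"
proof -
  have "{\<bar>det (submatrix A I J)\<bar> | I J.
      I \<subseteq> {..<dim_row A} \<and> J \<subseteq> {..<dim_col A} \<and> card I = dim_row A \<and> card J = dim_row A} =
    (\<lambda>J. \<bar>det (submatrix A {..<m} J)\<bar>) ` {J. J \<subseteq> {..<n} \<and> card J = m}"
    (is "?L = ?R")
  proof
    show "?L \<subseteq> ?R" using A by (auto dest: card_subset_eq[rotated])
    show "?R \<subseteq> ?L" using A by fastforce
  qed
  also have "\<dots> = (\<lambda>J. \<bar>minor m (\<lambda>i j. A $$ (i, j)) (pick J)\<bar>) ` {J. J \<subseteq> {..<n} \<and> card J = m}"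
    using det_submatrix_eq_minor[OF A] by (intro image_cong) auto
  finally show ?thesis unfolding Delta_def Delta_k_def by simp
qed

text \<open>\<open>Delta\<close> lists the chosen columns in increasing order, while
  \<open>f\<close> lists them arbitrarily. Sending \<open>k\<close> to the rank of
  \<open>f k\<close> among the chosen columns is a permutation \<open>p\<close>, which changes the
  minor by a sign at most.\<close>

lemma abs_minor_le_Delta:
  assumes A: "A \<in> carrier_mat m n" and f: "\<And>k. k < m \<Longrightarrow> f k < n" and inj: "inj_on f {..<m}"
  shows "\<bar>minor m (\<lambda>i j. A $$ (i, j)) f\<bar> \<le> Delta A"
proof -
  let ?a = "\<lambda>i j. A $$ (i, j)"
  define J where "J = f ` {..<m}"
  have J: "J \<subseteq> {..<n}" "card J = m" "finite J" using f inj by (auto simp: J_def card_image)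
  define p where "p = (\<lambda>k. if k < m then card {x \<in> J. x < f k} else k)"
  have pick: "pick J (p k) = f k" if "k < m" for k
    using that pick_card_in_set[of "f k" J] by (simp add: p_def J_def)
  have p: "p permutes {0..<m}"
  proof (rule bij_imp_permutes)
    have "p k < m" if "k < m" for k
    proof -
      have "{x \<in> J. x < f k} \<subset> J" using that by (auto simp: J_def)
      then show ?thesis using psubset_card_mono[OF J(3)] J(2) that by (simp add: p_def)
    qed
    moreover have "inj_on p {0..<m}"
      using inj pick by (intro inj_onI) (metis atLeastLessThan_iff inj_on_def lessThan_iff)
    ultimately show "bij_betw p {0..<m} {0..<m}"
      by (intro bij_betw_imageI endo_inj_surj) auto
  qed (simp add: p_def)
  have "minor m ?a f = minor m ?a (\<lambda>k. pick J (p k))"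
    unfolding minor_def by (rule fdet_cong) (simp add: pick)
  then have "\<bar>minor m ?a f\<bar> = \<bar>minor m ?a (pick J)\<bar>" using abs_minor_permute[OF p, of ?a "pick J"] by simp
  also have "\<dots> \<le> Delta A" unfolding Delta_eq_Max[OF A]
    by (rule Max_ge) (use J in auto)
  finally show ?thesis .
qed

lemma Delta_attained:
  assumes A: "A \<in> carrier_mat m n" and "m \<le> n"
  obtains f where "\<And>k. k < m \<Longrightarrow> f k < n" and "\<bar>minor m (\<lambda>i j. A $$ (i, j)) f\<bar> = Delta A"
proof -
  have "{..<m} \<in> {J. J \<subseteq> {..<n} \<and> card J = m}" using assms(2) by auto
  then have "Delta A \<in> (\<lambda>J. \<bar>minor m (\<lambda>i j. A $$ (i, j)) (pick J)\<bar>) ` {J. J \<subseteq> {..<n} \<and> card J = m}"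
    unfolding Delta_eq_Max[OF A] by (intro Max_in) (simp, blast)
  then obtain J where J: "J \<subseteq> {..<n}" "card J = m" "\<bar>minor m (\<lambda>i j. A $$ (i, j)) (pick J)\<bar> = Delta A"
    by auto
  show thesis using J pick_in_set_le[of _ J] by (intro that[of "pick J"]) auto
qed

text \<open>A maximal independent set of columns has as many elements as the rank, here
  \<open>m\<close>; listed as a square matrix it has full rank, hence nonzero determinant.\<close>

lemma full_rank_nonzero_minor:
  assumes A: "(A :: int mat) \<in> carrier_mat m n"
    and rank: "vec_space.rank m (map_mat real_of_int A) = m"
  obtains f where "\<And>k. k < m \<Longrightarrow> f k < n" and "minor m (\<lambda>i j. A $$ (i, j)) f \<noteq> 0"
proof -
  let ?A = "map_mat real_of_int A"
  interpret vec_space "TYPE(real)" m .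
  have A': "?A \<in> carrier_mat m n" using A by simp
  let ?P = "\<lambda>T. T \<subseteq> set (cols ?A) \<and> lin_indpt T"
  obtain S where S: "maximal S ?P"
    using maximal_exists[of ?P "card (set (cols ?A))" "{}"]
    by (meson List.finite_set card_mono empty_iff empty_subsetI finite_lin_indpt2 rev_finite_subset)
  have cS: "card S = m" using rank_card_indpt[OF A' S] rank by simp
  have sub: "S \<subseteq> set (cols ?A)" and ind: "lin_indpt S" using S by (auto simp: maximal_def)
  obtain us where us: "set us = S" "distinct us"
    using finite_distinct_list finite_subset[OF sub] by blast
  have len: "length us = m" using us cS distinct_card by fastforce
  have "\<exists>j<n. us ! k = col ?A j" if "k < m" for k
  proof -
    have "us ! k \<in> set (cols ?A)" using sub us len that by auto
    then show ?thesis using A' by (auto simp: in_set_conv_nth)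
  qed
  then obtain f where f: "\<And>k. k < m \<Longrightarrow> f k < n" "\<And>k. k < m \<Longrightarrow> us ! k = col ?A (f k)" by metis
  let ?B = "Matrix.mat m m (\<lambda>(i, k). real_of_int (A $$ (i, f k)))"
  have cols: "cols ?B = us"
    using f A len by (intro nth_equalityI) (auto intro!: eq_vecI)
  have "rank ?B = m"
    by (rule lin_indpt_full_rank) (use cols us ind in auto)
  then have "det ?B \<noteq> 0" using det_rank_iff[of ?B] by simp
  then have "minor m (\<lambda>i j. A $$ (i, j)) f \<noteq> 0"
    unfolding minor_def using fdet_of_int[of m "\<lambda>i k. A $$ (i, f k)"] by (auto simp: fdet_def)
  then show thesis using f that by blast
qed

section \<open>Circuits and conformal rounding\<close>

lemma finite_nonempty_minimizer:
  fixes h :: "'a \<Rightarrow> 'b::linorder"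
  assumes "finite S" "S \<noteq> {}"
  obtains k where "k \<in> S" "\<And>j. j \<in> S \<Longrightarrow> h k \<le> h j"
proof -
  have "Min (h ` S) \<in> h ` S" using assms by (intro Min_in) auto
  then obtain k where "k \<in> S" "h k = Min (h ` S)" by force
  then show thesis using assms by (intro that[of k]) auto
qed

text \<open>A choice of columns is any map \<open>f\<close>, repetitions included, so that an
  exchange \<open>f(i := j)\<close> with \<open>j < n\<close> stays within the class. The nonzero
  minor expresses full row rank.\<close>

locale full_rank_matrix =
  fixes m n :: nat and a :: "nat \<Rightarrow> nat \<Rightarrow> int" and D :: int
  assumes minor_le: "(\<And>k. k < m \<Longrightarrow> f k < n) \<Longrightarrow> \<bar>minor m a f\<bar> \<le> D"
    and minor_attained: "\<exists>f. (\<forall>k<m. f k < n) \<and> minor m a f \<noteq> 0 \<and> \<bar>minor m a f\<bar> = D"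
begin

lemma D_pos: "D > 0"
  using minor_attained by force

text \<open>Kernel vectors are functions that vanish from \<open>n\<close> on, so that equality of
  vectors is equality of functions.\<close>

definition in_ker :: "(nat \<Rightarrow> real) \<Rightarrow> bool" where
  "in_ker v \<longleftrightarrow> (\<forall>j\<ge>n. v j = 0) \<and> (\<forall>i<m. (\<Sum>j<n. of_int (a i j) * v j) = 0)"

lemma in_ker_0: "in_ker (\<lambda>_. 0)"
  by (simp add: in_ker_def)

lemma in_ker_diff: "in_ker v \<Longrightarrow> in_ker w \<Longrightarrow> in_ker (\<lambda>j. v j - c * w j)"
proof -
  assume v: "in_ker v" and w: "in_ker w"
  have "(\<Sum>j<n. of_int (a i j) * (v j - c * w j)) =
      (\<Sum>j<n. of_int (a i j) * v j) - c * (\<Sum>j<n. of_int (a i j) * w j)" for i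
    by (simp add: algebra_simps sum_subtractf sum_distrib_left)
  then show ?thesis using v w by (simp add: in_ker_def)
qed

lemma in_ker_finite_support: "in_ker v \<Longrightarrow> finite {j. v j \<noteq> 0}"
  by (rule finite_subset[of _ "{..<n}"]) (auto simp: in_ker_def intro: leI)

lemma in_ker_basis_eq_0:
  assumes v: "in_ker v" and f: "\<And>k. k < m \<Longrightarrow> f k < n" and nz: "minor m a f \<noteq> 0"
    and supp: "\<And>j. v j \<noteq> 0 \<Longrightarrow> j \<in> f ` {..<m}"
  shows "v = (\<lambda>_. 0)"
proof -
  have inj: "inj_on f {..<m}" using nz minor_eq_0 by blast
  have "(\<Sum>k<m. of_int (a i (f k)) * v (f k)) = 0" if "i < m" for i
  proof -
    have "(\<Sum>k<m. of_int (a i (f k)) * v (f k)) = (\<Sum>j\<in>f ` {..<m}. of_int (a i j) * v j)"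
      by (simp add: sum.reindex[OF inj])
    also have "\<dots> = (\<Sum>j<n. of_int (a i j) * v j)"
      using f supp by (intro sum.mono_neutral_left) auto
    finally show ?thesis using v that by (simp add: in_ker_def)
  qed
  then have "v (f k) = 0" if "k < m" for k
    using fdet_nonzero_kernel[of m "\<lambda>i k. of_int (a i (f k))" "\<lambda>k. v (f k)" k] nz that
    by (simp add: minor_def fdet_of_int)
  then show ?thesis using supp by blast
qed

text \<open>For a basis \<open>f\<close> and a column \<open>j\<close> outside it, this is the
  fundamental circuit of \<open>j\<close>, scaled by the basis minor to be integral. The sum over
  \<open>i\<close> reads off the coefficient at \<open>l\<close> without inverting
  \<open>f\<close>.\<close>

definition cramer_vec :: "(nat \<Rightarrow> nat) \<Rightarrow> nat \<Rightarrow> nat \<Rightarrow> int" where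
  "cramer_vec f j l = (if l = j then minor m a f else 0) -
     (\<Sum>i<m. if f i = l then minor m a (f(i := j)) else 0)"

lemma in_ker_cramer_vec:
  assumes f: "\<And>k. k < m \<Longrightarrow> f k < n" and j: "j < n"
  shows "in_ker (\<lambda>l. of_int (cramer_vec f j l))"
proof -
  have "(\<Sum>l<n. a r l * cramer_vec f j l) = 0" if r: "r < m" for r
  proof -
    have "(\<Sum>l<n. a r l * cramer_vec f j l) =
        (\<Sum>l<n. if l = j then minor m a f * a r j else 0) -
        (\<Sum>l<n. \<Sum>i<m. if f i = l then minor m a (f(i := j)) * a r (f i) else 0)"
      unfolding sum_subtractf[symmetric] cramer_vec_def right_diff_distrib sum_distrib_left
      by (intro sum.cong arg_cong2[where f = "(-)"]) auto
    also have "(\<Sum>l<n. \<Sum>i<m. if f i = l then minor m a (f(i := j)) * a r (f i) else 0) =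
        (\<Sum>i<m. \<Sum>l<n. if f i = l then minor m a (f(i := j)) * a r (f i) else 0)"
      by (rule sum.swap)
    also have "\<dots> = (\<Sum>i<m. minor m a (f(i := j)) * a r (f i))"
      using f by (intro sum.cong) auto
    finally show ?thesis using j minor_cramer[OF r, of a f j] by simp
  qed
  then have "(\<Sum>l<n. real_of_int (a r l) * of_int (cramer_vec f j l)) = 0" if "r < m" for r
    using that by (simp flip: of_int_mult of_int_sum)
  moreover have "cramer_vec f j l = 0" if "l \<ge> n" for l
    using f j that by (force simp: cramer_vec_def intro!: sum.neutral)
  ultimately show ?thesis by (simp add: in_ker_def)
qed

lemma cramer_vec_support:
  "cramer_vec f j l \<noteq> 0 \<Longrightarrow> l = j \<or> (\<exists>i<m. f i = l \<and> minor m a (f(i := j)) \<noteq> 0)"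
proof (rule ccontr)
  assume nz: "cramer_vec f j l \<noteq> 0" and "\<not> ?thesis"
  then have "l \<noteq> j" "(\<Sum>i<m. if f i = l then minor m a (f(i := j)) else 0) = 0"
    by (auto intro!: sum.neutral)
  then show False using nz by (simp add: cramer_vec_def)
qed

lemma cramer_vec_self: "j \<notin> f ` {..<m} \<Longrightarrow> cramer_vec f j j = minor m a f"
proof -
  assume "j \<notin> f ` {..<m}"
  then have "(\<Sum>i<m. if f i = j then minor m a (f(i := j)) else 0) = 0"
    by (intro sum.neutral) auto
  then show ?thesis by (simp add: cramer_vec_def)
qed

text \<open>The vector is assembled from \<open>m + 1\<close> maximal minors, each of modulus at
  most \<open>D\<close> and each entering a single coordinate.\<close>

lemma cramer_vec_l1:
  assumes f: "\<And>k. k < m \<Longrightarrow> f k < n" and j: "j < n"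
  shows "(\<Sum>l<n. \<bar>cramer_vec f j l\<bar>) \<le> (int m + 1) * D"
proof -
  have fj: "\<bar>minor m a (f(i := j))\<bar> \<le> D" for i
    using f j by (intro minor_le) auto
  have "(\<Sum>l<n. \<bar>cramer_vec f j l\<bar>) \<le>
      (\<Sum>l<n. (if l = j then \<bar>minor m a f\<bar> else 0) +
        (\<Sum>i<m. if f i = l then \<bar>minor m a (f(i := j))\<bar> else 0))"
  proof (rule sum_mono)
    fix l
    have "\<bar>\<Sum>i<m. if f i = l then minor m a (f(i := j)) else 0\<bar> \<le>
        (\<Sum>i<m. if f i = l then \<bar>minor m a (f(i := j))\<bar> else 0)"
      by (rule order_trans[OF sum_abs]) (auto intro!: sum_mono)
    then show "\<bar>cramer_vec f j l\<bar> \<le> (if l = j then \<bar>minor m a f\<bar> else 0) +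
        (\<Sum>i<m. if f i = l then \<bar>minor m a (f(i := j))\<bar> else 0)"
      unfolding cramer_vec_def by (auto split: if_splits)
  qed
  also have "\<dots> = \<bar>minor m a f\<bar> +
      (\<Sum>l<n. \<Sum>i<m. if f i = l then \<bar>minor m a (f(i := j))\<bar> else 0)"
    using j by (simp add: sum.distrib)
  also have "(\<Sum>l<n. \<Sum>i<m. if f i = l then \<bar>minor m a (f(i := j))\<bar> else 0) =
      (\<Sum>i<m. \<Sum>l<n. if f i = l then \<bar>minor m a (f(i := j))\<bar> else 0)"
    by (rule sum.swap)
  also have "\<dots> = (\<Sum>i<m. \<bar>minor m a (f(i := j))\<bar>)"
    using f by (intro sum.cong) auto
  also have "\<dots> \<le> (\<Sum>i<m. D)" by (intro sum_mono fj)
  finally have "(\<Sum>l<n. \<bar>cramer_vec f j l\<bar>) \<le> \<bar>minor m a f\<bar> + int m * D" by simp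
  moreover have "\<bar>minor m a f\<bar> \<le> D" by (rule minor_le) (rule f)
  ultimately show ?thesis by (simp add: algebra_simps)
qed

text \<open>Basis exchange: take a basis \<open>f\<close> that covers as much of \<open>J\<close> as
  possible. If \<open>j\<close> in \<open>J\<close> were left out, its circuit could not be
  supported in \<open>J\<close>, so it would involve some \<open>f i\<close> outside
  \<open>J\<close>; replacing \<open>f i\<close> by \<open>j\<close> would cover one more
  element.\<close>

lemma independent_extends_to_basis:
  assumes J: "J \<subseteq> {..<n}"
    and ind: "\<And>v. in_ker v \<Longrightarrow> (\<And>j. v j \<noteq> 0 \<Longrightarrow> j \<in> J) \<Longrightarrow> v = (\<lambda>_. 0)"
  obtains f where "\<And>k. k < m \<Longrightarrow> f k < n" "minor m a f \<noteq> 0" "J \<subseteq> f ` {..<m}"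
proof -
  let ?P = "\<lambda>f. (\<forall>k<m. f k < n) \<and> minor m a f \<noteq> 0" and ?c = "\<lambda>f. card (J \<inter> f ` {..<m})"
  have finJ: "finite J" using J finite_subset by blast
  obtain f0 where f0: "?P f0" using minor_attained by blast
  have "\<forall>f. ?P f \<longrightarrow> ?c f < Suc (card J)" using finJ by (auto intro: card_mono simp: less_Suc_eq_le)
  then obtain f where f: "?P f" and max: "\<And>g. ?P g \<Longrightarrow> ?c g \<le> ?c f"
    using ex_has_greatest_nat[of ?P f0 ?c "Suc (card J)"] f0 by blast
  have "J \<subseteq> f ` {..<m}"
  proof (rule ccontr)
    assume "\<not> J \<subseteq> f ` {..<m}"
    then obtain j where j: "j \<in> J" "j \<notin> f ` {..<m}" by blast
    have jn: "j < n" using j J by auto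
    have "\<exists>i<m. f i \<notin> J \<and> minor m a (f(i := j)) \<noteq> 0"
    proof (rule ccontr)
      assume no: "\<not> ?thesis"
      have "(\<lambda>l. real_of_int (cramer_vec f j l)) = (\<lambda>_. 0)"
      proof (rule ind)
        show "in_ker (\<lambda>l. real_of_int (cramer_vec f j l))" using f jn by (intro in_ker_cramer_vec) auto
        show "l \<in> J" if "real_of_int (cramer_vec f j l) \<noteq> 0" for l
          using that cramer_vec_support[of f j l] no j by auto
      qed
      then have "cramer_vec f j j = 0" by (metis of_int_eq_0_iff)
      then show False using cramer_vec_self[OF j(2)] f by simp
    qed
    then obtain i where i: "i < m" "f i \<notin> J" "minor m a (f(i := j)) \<noteq> 0" by blast
    have "insert j (J \<inter> f ` {..<m}) \<subseteq> J \<inter> (f(i := j)) ` {..<m}"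
      using i j by auto
    then have "card (insert j (J \<inter> f ` {..<m})) \<le> ?c (f(i := j))"
      using finJ by (intro card_mono) auto
    moreover have "card (insert j (J \<inter> f ` {..<m})) = Suc (?c f)"
      using finJ j by (subst card_insert_disjoint) auto
    moreover have "?c (f(i := j)) \<le> ?c f" using f i jn by (intro max) auto
    ultimately show False by linarith
  qed
  then show thesis using f that by blast
qed

text \<open>A nonzero kernel vector \<open>v\<close> of minimal support, among those with signs
  compatible with \<open>d\<close>, has independent columns once one index \<open>j0\<close> is
  removed. Extending these to a basis makes \<open>v\<close> proportional to the Cramer vector of
  \<open>j0\<close>, which is integral and short.\<close>

lemma conformal_circuit:
  assumes d: "in_ker d" "d \<noteq> (\<lambda>_. 0)"
  obtains u :: "nat \<Rightarrow> int" where "in_ker (\<lambda>j. of_int (u j))" "u \<noteq> (\<lambda>_. 0)"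
    "\<And>j. d j = 0 \<Longrightarrow> u j = 0" "\<And>j. of_int (u j) * d j \<ge> 0"
    "(\<Sum>j<n. \<bar>u j\<bar>) \<le> (int m + 1) * D"
proof -
  let ?P = "\<lambda>v. in_ker v \<and> v \<noteq> (\<lambda>_. 0) \<and> (\<forall>j. d j = 0 \<longrightarrow> v j = 0) \<and> (\<forall>j. v j * d j \<ge> 0)"
  have "?P d" using d by simp
  then obtain v where v: "?P v"
    and min: "\<And>w. ?P w \<Longrightarrow> card {j. v j \<noteq> 0} \<le> card {j. w j \<noteq> 0}"
    using ex_has_least_nat[of ?P d "\<lambda>v. card {j. v j \<noteq> 0}"] by blast
  obtain j0 where j0: "v j0 \<noteq> 0" using v by (auto simp: fun_eq_iff)
  let ?J = "{j. v j \<noteq> 0} - {j0}"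
  have Jn: "{j. v j \<noteq> 0} \<subseteq> {..<n}" using v by (auto simp: in_ker_def intro: leI)
  have ind: "w = (\<lambda>_. 0)" if w: "in_ker w" and supp: "\<And>j. w j \<noteq> 0 \<Longrightarrow> j \<in> ?J" for w
  proof (rule ccontr)
    assume nz: "w \<noteq> (\<lambda>_. 0)"
    have finW: "finite {j. w j \<noteq> 0}" using in_ker_finite_support[OF w] .
    \<comment> \<open>The minimal ratio gives the first coordinate to vanish along \<open>w\<close>;
      no coordinate of \<open>v\<close> has changed sign before. Since \<open>w j0 = 0\<close>, the
      entry at \<open>j0\<close> survives and the result is nonzero.\<close>
    obtain k where k: "w k \<noteq> 0" and kmin: "\<And>j. w j \<noteq> 0 \<Longrightarrow> \<bar>v k / w k\<bar> \<le> \<bar>v j / w j\<bar>"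
      by (rule finite_nonempty_minimizer[OF finW, of "\<lambda>j. \<bar>v j / w j\<bar>"]) (use nz in auto)
    define t where "t = v k / w k"
    define v' where "v' = (\<lambda>j. v j - t * w j)"
    have le: "\<bar>t * w j\<bar> \<le> \<bar>v j\<bar>" for j
    proof (cases "w j = 0")
      case False
      then show ?thesis using kmin[OF False] by (simp add: t_def abs_mult field_simps)
    qed simp
    have "v' j * d j \<ge> 0" for j
    proof -
      have "v j * d j \<ge> 0" using v by blast
      then show ?thesis using le[of j] unfolding v'_def
        by (cases "d j" "0::real" rule: linorder_cases)
           (auto simp: zero_le_mult_iff abs_if split: if_splits)
    qed
    moreover have "v' j = 0" if "d j = 0" for j
      using v that le[of j] by (simp add: v'_def)
    moreover have "v' j0 = v j0" using supp[of j0] by (auto simp: v'_def)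
    then have "v' \<noteq> (\<lambda>_. 0)" using j0 by auto
    moreover have "in_ker v'" unfolding v'_def using v w by (intro in_ker_diff) auto
    ultimately have "card {j. v j \<noteq> 0} \<le> card {j. v' j \<noteq> 0}" by (intro min) auto
    moreover have "{j. v' j \<noteq> 0} \<subset> {j. v j \<noteq> 0}"
    proof -
      have "v' k = 0" using k by (simp add: v'_def t_def)
      moreover have "v k \<noteq> 0" using supp[OF k] by simp
      moreover have "v' j = 0" if "v j = 0" for j using le[of j] that by (simp add: v'_def)
      ultimately show ?thesis by blast
    qed
    ultimately show False
      using psubset_card_mono[of "{j. v j \<noteq> 0}"] in_ker_finite_support v by (metis not_less)
  qed
  obtain f where f: "\<And>k. k < m \<Longrightarrow> f k < n" "minor m a f \<noteq> 0" "?J \<subseteq> f ` {..<m}"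
    by (rule independent_extends_to_basis[of ?J]) (use Jn ind in blast)+
  have j0f: "j0 \<notin> f ` {..<m}"
  proof
    assume "j0 \<in> f ` {..<m}"
    then have "j \<in> f ` {..<m}" if "v j \<noteq> 0" for j using that f(3) by blast
    then show False using in_ker_basis_eq_0[OF _ f(1,2), of v] v by blast
  qed
  have j0n: "j0 < n" using Jn j0 by auto
  define c where "c = real_of_int (cramer_vec f j0 j0) / v j0"
  have "(\<lambda>j. real_of_int (cramer_vec f j0 j) - c * v j) = (\<lambda>_. 0)"
  proof (rule in_ker_basis_eq_0[OF _ f(1,2)])
    show "in_ker (\<lambda>j. real_of_int (cramer_vec f j0 j) - c * v j)"
      using v f j0n by (intro in_ker_diff in_ker_cramer_vec) auto
    fix j assume nz: "real_of_int (cramer_vec f j0 j) - c * v j \<noteq> 0"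
    then have "j \<noteq> j0" using j0 by (auto simp: c_def)
    moreover have "cramer_vec f j0 j \<noteq> 0 \<or> v j \<noteq> 0" using nz by auto
    ultimately show "j \<in> f ` {..<m}" using cramer_vec_support[of f j0 j] f(3) by blast
  qed
  then have cv: "real_of_int (cramer_vec f j0 j) = c * v j" for j
    by (meson eq_iff_diff_eq_0 fun_cong)
  have c0: "c \<noteq> 0" using cramer_vec_self[OF j0f] f(2) j0 by (simp add: c_def)
  \<comment> \<open>The sign makes \<open>u\<close> a positive multiple of \<open>v\<close>, so it
    inherits the sign compatibility with \<open>d\<close>.\<close>
  define \<sigma> :: int where "\<sigma> = (if c > 0 then 1 else -1)"
  define u where "u = (\<lambda>j. \<sigma> * cramer_vec f j0 j)"
  have u: "real_of_int (u j) = \<bar>c\<bar> * v j" for j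
    unfolding u_def \<sigma>_def using cv[of j] by auto
  have "in_ker (\<lambda>j. of_int (u j))"
    unfolding u using in_ker_diff[OF in_ker_0, of v "- \<bar>c\<bar>"] v by simp
  moreover have "u \<noteq> (\<lambda>_. 0)"
    using u[of j0] c0 j0 by (metis abs_eq_0 mult_eq_0_iff of_int_0)
  moreover have "u j = 0" if "d j = 0" for j
    using u[of j] v that by simp
  moreover have "of_int (u j) * d j \<ge> 0" for j
    unfolding u using v by (simp add: mult.assoc)
  moreover have "(\<Sum>j<n. \<bar>u j\<bar>) \<le> (int m + 1) * D"
    using cramer_vec_l1[OF f(1) j0n] by (simp add: u_def \<sigma>_def abs_mult)
  ultimately show thesis using that by blast
qed

text \<open>The functionals in \<open>\<Phi>\<close> certify that the kernel vectors supported on the support of \<open>d\<close> form a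
  space of dimension at most \<open>q\<close>; each circuit that is split off lowers this dimension by one.\<close>

lemma conformal_rounding:
  fixes \<Phi> :: "((nat \<Rightarrow> real) \<Rightarrow> real) set"
  assumes "in_ker d" "finite \<Phi>" "card \<Phi> \<le> q"
    and "\<And>\<phi> v w c. \<phi> \<in> \<Phi> \<Longrightarrow> \<phi> (\<lambda>j. v j - c * w j) = \<phi> v - c * \<phi> w"
    and "\<And>v. in_ker v \<Longrightarrow> (\<And>j. d j = 0 \<Longrightarrow> v j = 0) \<Longrightarrow> (\<And>\<phi>. \<phi> \<in> \<Phi> \<Longrightarrow> \<phi> v = 0) \<Longrightarrow> v = (\<lambda>_. 0)"
  shows "\<exists>u :: nat \<Rightarrow> int. in_ker (\<lambda>j. of_int (u j)) \<and>
    (\<forall>j. 0 \<le> real_of_int (u j) \<and> of_int (u j) \<le> d j \<or> d j \<le> of_int (u j) \<and> real_of_int (u j) \<le> 0) \<and>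
    (\<Sum>j<n. \<bar>d j - of_int (u j)\<bar>) \<le> real q * ((real m + 1) * of_int D) \<and>
    (q > 0 \<longrightarrow> (\<Sum>j<n. \<bar>d j - of_int (u j)\<bar>) < real q * ((real m + 1) * of_int D))"
  using assms
proof (induction q arbitrary: d \<Phi>)
  case 0
  have "d = (\<lambda>_. 0)"
    by (rule 0(5)) (use 0(1-3) in auto)
  then show ?case by (intro exI[of _ "\<lambda>_. 0"]) (simp add: in_ker_0)
next
  case (Suc q)
  note lin = Suc.prems(4) and sep = Suc.prems(5)
  let ?M = "(real m + 1) * of_int D"
  have M: "?M > 0" using D_pos by simp
  show ?case
  proof (cases "d = (\<lambda>_. 0)")
    case True
    then show ?thesis using M by (intro exI[of _ "\<lambda>_. 0"]) (simp add: in_ker_0)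
  next
    case False
    obtain u :: "nat \<Rightarrow> int" where u: "in_ker (\<lambda>j. of_int (u j))" "u \<noteq> (\<lambda>_. 0)"
        "\<And>j. d j = 0 \<Longrightarrow> u j = 0" "\<And>j. of_int (u j) * d j \<ge> 0"
        "(\<Sum>j<n. \<bar>u j\<bar>) \<le> (int m + 1) * D"
      using conformal_circuit[OF Suc.prems(1) False] by blast
    define ur where "ur = (\<lambda>j. real_of_int (u j))"
    have urnz: "ur \<noteq> (\<lambda>_. 0)" using u(2) by (auto simp: ur_def fun_eq_iff)
    have ur_l1: "(\<Sum>j<n. \<bar>ur j\<bar>) \<le> ?M"
    proof -
      have "real_of_int (\<Sum>j<n. \<bar>u j\<bar>) \<le> real_of_int ((int m + 1) * D)"
        using u(5) by (simp only: of_int_le_iff)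
      then show ?thesis by (simp add: ur_def)
    qed
    have kerur: "in_ker ur" using u(1) by (simp add: ur_def)
    have finU: "finite {j. u j \<noteq> 0}" using in_ker_finite_support[OF kerur] by (simp add: ur_def)
    \<comment> \<open>The least ratio is the largest multiple of \<open>ur\<close> that can be split
      off from \<open>d\<close> conformally; coordinate \<open>k\<close> becomes zero.\<close>
    obtain k where k: "u k \<noteq> 0" and kmin: "\<And>j. u j \<noteq> 0 \<Longrightarrow> d k / ur k \<le> d j / ur j"
      by (rule finite_nonempty_minimizer[OF finU, of "\<lambda>j. d j / ur j"]) (use u(2) in auto)
    define t where "t = d k / ur k"
    have dk: "d k \<noteq> 0" using u(3) k by blast
    have t: "t \<ge> 0" using u(4)[of k] by (auto simp: t_def ur_def zero_le_divide_iff zero_le_mult_iff)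
    define d' where "d' = (\<lambda>j. d j - t * ur j)"
    have conf: "0 \<le> t * ur j \<and> t * ur j \<le> d j \<or> d j \<le> t * ur j \<and> t * ur j \<le> 0" for j
    proof (cases "u j = 0")
      case True
      then show ?thesis by (auto simp: ur_def)
    next
      case False
      then have "t \<le> d j / ur j" unfolding t_def by (rule kmin)
      moreover have "ur j > 0 \<and> d j \<ge> 0 \<or> ur j < 0 \<and> d j \<le> 0"
        using u(4)[of j] False by (auto simp: ur_def zero_le_mult_iff)
      ultimately show ?thesis using t
        by (auto simp: field_simps mult_nonneg_nonpos)
    qed
    have d'k: "d' k = 0" using k by (simp add: d'_def t_def ur_def)
    have d'0: "d' j = 0" if "d j = 0" for j using u(3)[OF that] that by (simp add: d'_def ur_def)
    have kerd': "in_ker d'" unfolding d'_def using Suc.prems(1) kerur by (rule in_ker_diff)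
    obtain \<phi>0 where \<phi>0: "\<phi>0 \<in> \<Phi>" "\<phi>0 ur \<noteq> 0"
      using sep[OF kerur] u(3) urnz by (auto simp: ur_def)
    \<comment> \<open>Elimination with pivot \<open>\<phi>0\<close>: the new functionals all vanish
      at \<open>ur\<close>, and there is one fewer of them.\<close>
    define \<Psi> where "\<Psi> = (\<lambda>\<phi> v. \<phi> v - \<phi> ur / \<phi>0 ur * \<phi>0 v) ` (\<Phi> - {\<phi>0})"
    have fin\<Psi>: "finite \<Psi>" using Suc.prems(2) by (simp add: \<Psi>_def)
    have "card \<Psi> \<le> card (\<Phi> - {\<phi>0})"
      unfolding \<Psi>_def using Suc.prems(2) by (intro card_image_le) auto
    then have card\<Psi>: "card \<Psi> \<le> q" using \<phi>0 Suc.prems(2,3) by simp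
    have lin\<Psi>: "\<psi> (\<lambda>j. v j - c * w j) = \<psi> v - c * \<psi> w" if "\<psi> \<in> \<Psi>" for \<psi> v w c
      using that \<phi>0 unfolding \<Psi>_def by (auto simp: lin algebra_simps diff_divide_distrib)
    have sep\<Psi>: "v = (\<lambda>_. 0)" if v: "in_ker v" "\<And>j. d' j = 0 \<Longrightarrow> v j = 0" "\<And>\<psi>. \<psi> \<in> \<Psi> \<Longrightarrow> \<psi> v = 0" for v
    proof -
      \<comment> \<open>Subtracting \<open>e * ur\<close> from \<open>v\<close> makes
        \<open>\<phi>0\<close> vanish as well, so the difference is zero by \<open>sep\<close>.
        Hence \<open>v\<close> is a multiple of \<open>ur\<close>, and coordinate \<open>k\<close>,
        where \<open>v\<close> vanishes but \<open>ur\<close> does not, forces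
        \<open>e = 0\<close>.\<close>
      define e where "e = \<phi>0 v / \<phi>0 ur"
      have w0: "(\<lambda>j. v j - e * ur j) = (\<lambda>_. 0)"
      proof (rule sep)
        show "in_ker (\<lambda>j. v j - e * ur j)" using v(1) kerur by (rule in_ker_diff)
        show "v j - e * ur j = 0" if "d j = 0" for j
          using v(2)[OF d'0[OF that]] u(3)[OF that] by (simp add: ur_def)
        show "\<phi> (\<lambda>j. v j - e * ur j) = 0" if "\<phi> \<in> \<Phi>" for \<phi>
        proof (cases "\<phi> = \<phi>0")
          case True
          then show ?thesis using \<phi>0 unfolding lin[OF that] by (simp add: e_def)
        next
          case False
          then have "(\<lambda>v. \<phi> v - \<phi> ur / \<phi>0 ur * \<phi>0 v) \<in> \<Psi>" using that by (auto simp: \<Psi>_def)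
          from v(3)[OF this] show ?thesis unfolding lin[OF that] by (simp add: e_def mult.commute)
        qed
      qed
      have "v k = e * ur k" using fun_cong[OF w0, of k] by simp
      then have "e = 0" using v(2)[OF d'k] k by (simp add: ur_def)
      then show ?thesis using w0 by simp
    qed
    obtain u' :: "nat \<Rightarrow> int" where u': "in_ker (\<lambda>j. of_int (u' j))"
      "\<And>j. 0 \<le> real_of_int (u' j) \<and> of_int (u' j) \<le> d' j \<or> d' j \<le> of_int (u' j) \<and> real_of_int (u' j) \<le> 0"
      "(\<Sum>j<n. \<bar>d' j - of_int (u' j)\<bar>) \<le> real q * ?M"
      using Suc.IH[OF kerd' fin\<Psi> card\<Psi> lin\<Psi> sep\<Psi>] by blast
    \<comment> \<open>Only the integer part of the coefficient \<open>t\<close> is kept. The lost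
      fraction is less than 1 and costs strictly less than \<open>?M\<close>, which is the source of
      the strict inequality.\<close>
    define v where "v = (\<lambda>j. u' j + \<lfloor>t\<rfloor> * u j)"
    have vr: "real_of_int (v j) = of_int (u' j) - (- of_int \<lfloor>t\<rfloor>) * ur j" for j
      by (simp add: v_def ur_def)
    have ft: "0 \<le> real_of_int \<lfloor>t\<rfloor>" "of_int \<lfloor>t\<rfloor> \<le> t" "t - of_int \<lfloor>t\<rfloor> < 1"
      using t by (simp, simp, linarith)
    have "in_ker (\<lambda>j. of_int (v j))" unfolding vr using u'(1) kerur by (rule in_ker_diff)
    moreover have "0 \<le> real_of_int (v j) \<and> of_int (v j) \<le> d j \<or> d j \<le> of_int (v j) \<and> real_of_int (v j) \<le> 0" for j
    proof -
      have fl: "0 \<le> ur j \<Longrightarrow> 0 \<le> of_int \<lfloor>t\<rfloor> * ur j \<and> of_int \<lfloor>t\<rfloor> * ur j \<le> t * ur j"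
        "ur j \<le> 0 \<Longrightarrow> of_int \<lfloor>t\<rfloor> * ur j \<le> 0 \<and> t * ur j \<le> of_int \<lfloor>t\<rfloor> * ur j"
        using ft by (auto intro: mult_right_mono mult_right_mono_neg mult_nonneg_nonpos)
      have d': "d' j = d j - t * ur j" by (simp add: d'_def)
      have "0 \<le> ur j \<and> 0 \<le> d j \<or> ur j \<le> 0 \<and> d j \<le> 0"
        using u(4)[of j] by (auto simp: ur_def zero_le_mult_iff)
      then show ?thesis using fl conf[of j] u'(2)[of j] unfolding vr d' by auto
    qed
    moreover have "(\<Sum>j<n. \<bar>d j - of_int (v j)\<bar>) < real (Suc q) * ?M"
    proof -
      have "(\<Sum>j<n. \<bar>d j - of_int (v j)\<bar>) \<le>
          (\<Sum>j<n. \<bar>d' j - of_int (u' j)\<bar> + (t - of_int \<lfloor>t\<rfloor>) * \<bar>ur j\<bar>)"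
      proof (rule sum_mono)
        fix j
        have "d j - of_int (v j) = (d' j - of_int (u' j)) + (t - of_int \<lfloor>t\<rfloor>) * ur j"
          unfolding vr d'_def by (simp add: algebra_simps)
        then show "\<bar>d j - of_int (v j)\<bar> \<le> \<bar>d' j - of_int (u' j)\<bar> + (t - of_int \<lfloor>t\<rfloor>) * \<bar>ur j\<bar>"
          using ft abs_triangle_ineq[of "d' j - of_int (u' j)" "(t - of_int \<lfloor>t\<rfloor>) * ur j"]
          by (simp add: abs_mult)
      qed
      also have "\<dots> \<le> real q * ?M + (t - of_int \<lfloor>t\<rfloor>) * ?M"
        unfolding sum.distrib sum_distrib_left[symmetric]
        using u'(3) ur_l1 ft by (intro add_mono mult_left_mono) auto
      also have "\<dots> < real q * ?M + 1 * ?M"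
        using ft M by (intro add_strict_left_mono mult_strict_right_mono) auto
      finally show ?thesis by (simp add: algebra_simps)
    qed
    ultimately show ?thesis by (intro exI[of _ v]) auto
  qed
qed

end

section \<open>Columns with distinct subset sums\<close>

context full_rank_matrix
begin

text \<open>A maximal minor serves as a basis in which, by Cramer's rule, all columns have coordinates
  in \<open>[-1, 1]\<close>.\<close>

lemma subset_sums_weight_bound:
  fixes g :: "real \<Rightarrow> real"
  assumes S: "S \<subseteq> {..<n}"
    and inj: "\<And>X Y. X \<subseteq> S \<Longrightarrow> Y \<subseteq> S \<Longrightarrow> (\<And>i. i < m \<Longrightarrow> (\<Sum>j\<in>X. a i j) = (\<Sum>j\<in>Y. a i j)) \<Longrightarrow> X = Y"
    and g: "\<And>t. g t \<ge> 0"
    and C: "\<And>K t. finite K \<Longrightarrow> (\<Sum>k\<in>K. g (of_int k + t)) \<le> C"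
  obtains h :: "nat \<Rightarrow> nat \<Rightarrow> real"
  where "\<And>i j. i < m \<Longrightarrow> j < n \<Longrightarrow> \<bar>h i j\<bar> \<le> 1"
    and "(\<Sum>X\<in>Pow S. \<Prod>i<m. g (\<Sum>j\<in>S. (if j \<in> X then 1/2 else -1/2) * h i j)) \<le> of_int D * C ^ m"
proof -
  obtain f where f: "\<And>k. k < m \<Longrightarrow> f k < n" and nz: "minor m a f \<noteq> 0" and fD: "\<bar>minor m a f\<bar> = D"
    using minor_attained by blast
  have finS: "finite S" using S finite_subset by blast
  define h where "h = (\<lambda>i j. real_of_int (minor m a (f(i := j))) / of_int (minor m a f))"
  have h1: "\<bar>h i j\<bar> \<le> 1" if "i < m" "j < n" for i j
  proof -
    have "\<bar>minor m a (f(i := j))\<bar> \<le> \<bar>minor m a f\<bar>"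
      unfolding fD by (rule minor_le) (use f that in auto)
    then have "real_of_int \<bar>minor m a (f(i := j))\<bar> \<le> of_int \<bar>minor m a f\<bar>"
      by (simp only: of_int_le_iff)
    then show ?thesis using nz by (simp add: h_def)
  qed
  have h: "(\<Sum>k<m. of_int (a i (f k)) * h k j) = of_int (a i j)" if "i < m" for i j
  proof -
    have "(\<Sum>k<m. of_int (a i (f k)) * h k j) =
        of_int (\<Sum>k<m. minor m a (f(k := j)) * a i (f k)) / of_int (minor m a f)"
      unfolding h_def by (simp add: sum_divide_distrib mult.commute)
    then show ?thesis using nz by (simp only: minor_cramer[OF that]) simp
  qed
  define w where "w = (\<lambda>X k. \<Sum>j\<in>X. h k j)"
  \<comment> \<open>Half of the total sum is subtracted, which turns the 0/1 indicators of
    \<open>X\<close> into signs 1/2 and -1/2.\<close>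
  define \<mu> where "\<mu> = (\<lambda>k. - (\<Sum>j\<in>S. h k j) / 2)"
  have "(\<Sum>X\<in>Pow S. \<Prod>i<m. g (w X i + \<mu> i)) \<le> of_int \<bar>fdet m (\<lambda>i k. a i (f k))\<bar> * C ^ m"
  proof (rule sum_lattice_weights_le[where p = "\<lambda>X i. \<Sum>j\<in>X. a i j"])
    show "fdet m (\<lambda>i k. a i (f k)) \<noteq> 0" using nz by (simp add: minor_def)
    show "finite (Pow S)" using finS by simp
    show "X = Y" if "X \<in> Pow S" "Y \<in> Pow S" "\<And>i. i < m \<Longrightarrow> (\<Sum>j\<in>X. a i j) = (\<Sum>j\<in>Y. a i j)" for X Y
      using inj that by auto
    show "(\<Sum>k<m. of_int (a i (f k)) * w X k) = of_int (\<Sum>j\<in>X. a i j)" if "i < m" for X i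
    proof -
      have "(\<Sum>k<m. of_int (a i (f k)) * w X k) = (\<Sum>j\<in>X. \<Sum>k<m. of_int (a i (f k)) * h k j)"
        unfolding w_def sum_distrib_left by (rule sum.swap)
      then show ?thesis using that by (simp add: h)
    qed
  qed (use g C in auto)
  moreover have "w X i + \<mu> i = (\<Sum>j\<in>S. (if j \<in> X then 1/2 else -1/2) * h i j)" if "X \<in> Pow S" for X i
  proof -
    have "(\<Sum>j\<in>S. (if j \<in> X then 1/2 else -1/2) * h i j) =
        (\<Sum>j\<in>S. (if j \<in> X then h i j else 0) - h i j / 2)"
      by (intro sum.cong) auto
    also have "\<dots> = (\<Sum>j\<in>S \<inter> X. h i j) + \<mu> i"
      using finS by (simp add: sum_subtractf sum.inter_restrict \<mu>_def sum_divide_distrib)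
    finally show ?thesis using that by (simp add: w_def Int_absorb1)
  qed
  ultimately have "(\<Sum>X\<in>Pow S. \<Prod>i<m. g (\<Sum>j\<in>S. (if j \<in> X then 1/2 else -1/2) * h i j)) \<le> of_int D * C ^ m"
    using fD by (simp add: minor_def flip: of_int_abs)
  with h1 show thesis by (rule that)
qed

text \<open>The weight is the indicator of an interval of length \<open>s = card S\<close> about 0.
  All centred subset sums lie in it because coordinates are at most 1 in modulus, and it meets a
  translate of the integers in at most \<open>s + 1\<close> points.\<close>

lemma distinct_subset_sums_box_bound:
  assumes S: "S \<subseteq> {..<n}"
    and inj: "\<And>X Y. X \<subseteq> S \<Longrightarrow> Y \<subseteq> S \<Longrightarrow> (\<And>i. i < m \<Longrightarrow> (\<Sum>j\<in>X. a i j) = (\<Sum>j\<in>Y. a i j)) \<Longrightarrow> X = Y"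
  shows "2 ^ card S \<le> real_of_int D * (real (card S) + 1) ^ m"
proof -
  let ?s = "real (card S)"
  have finS: "finite S" using S finite_subset by blast
  define g :: "real \<Rightarrow> real" where "g = (\<lambda>t. if \<bar>t\<bar> \<le> ?s / 2 then 1 else 0)"
  have g_nonneg: "g t \<ge> 0" for t by (simp add: g_def)
  have g_sum: "(\<Sum>k\<in>K. g (of_int k + t)) \<le> ?s + 1" if K: "finite K" for K t
  proof -
    let ?I = "{\<lceil>- ?s / 2 - t\<rceil>..\<lfloor>?s / 2 - t\<rfloor>}"
    have "(\<Sum>k\<in>K. g (of_int k + t)) = real (card {k \<in> K. \<bar>of_int k + t\<bar> \<le> ?s / 2})"
      using K by (simp add: g_def sum.If_cases Int_def)
    also have "\<dots> \<le> real (card ?I)"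
    proof (intro of_nat_mono card_mono subsetI)
      fix k assume "k \<in> {k \<in> K. \<bar>of_int k + t\<bar> \<le> ?s / 2}"
      then have "- ?s / 2 - t \<le> of_int k" "of_int k \<le> ?s / 2 - t" 
        by (simp_all only: mem_Collect_eq) linarith+
      then show "k \<in> ?I" by (simp add: ceiling_le_iff le_floor_iff)
    qed simp
    also have "\<dots> \<le> ?s + 1"
    proof -
      have "?s / 2 - t = (- ?s / 2 - t) + of_int (int (card S))" by simp
      then have "\<lfloor>?s / 2 - t\<rfloor> = \<lfloor>- ?s / 2 - t\<rfloor> + int (card S)"
        by (metis floor_add_int)
      moreover have "\<lfloor>- ?s / 2 - t\<rfloor> \<le> \<lceil>- ?s / 2 - t\<rceil>" by (rule floor_le_ceiling)
      ultimately have "card ?I \<le> card S + 1"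
        unfolding card_atLeastAtMost_int nat_le_iff by linarith
      then show ?thesis by linarith
    qed
    finally show ?thesis .
  qed
  obtain h where h: "\<And>i j. i < m \<Longrightarrow> j < n \<Longrightarrow> \<bar>h i j\<bar> \<le> 1"
    and le: "(\<Sum>X\<in>Pow S. \<Prod>i<m. g (\<Sum>j\<in>S. (if j \<in> X then 1/2 else -1/2) * h i j)) \<le> of_int D * (?s + 1) ^ m"
  proof -
    show thesis
      by (rule subset_sums_weight_bound[OF S inj g_nonneg g_sum]; (blast | (rule that; simp)))
  qed
  have "g (\<Sum>j\<in>S. (if j \<in> X then 1/2 else -1/2) * h i j) = 1" if "i < m" for X i
  proof -
    have "\<bar>\<Sum>j\<in>S. (if j \<in> X then 1/2 else -1/2) * h i j\<bar> \<le> (\<Sum>j\<in>S. 1/2)"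
      by (rule order_trans[OF sum_abs sum_mono]) (use S h[OF that] in auto)
    then show ?thesis by (simp add: g_def)
  qed
  then show ?thesis using le finS by (simp add: card_Pow)
qed

text \<open>Each coordinate of a random subset sum has variance at most \<open>card S / 4\<close>.
  By Jensen's inequality the total Gaussian weight is therefore large, while the lattice bound caps
  it.\<close>

lemma distinct_subset_sums_gaussian_bound:
  assumes S: "S \<subseteq> {..<n}"
    and inj: "\<And>X Y. X \<subseteq> S \<Longrightarrow> Y \<subseteq> S \<Longrightarrow> (\<And>i. i < m \<Longrightarrow> (\<Sum>j\<in>X. a i j) = (\<Sum>j\<in>Y. a i j)) \<Longrightarrow> X = Y"
  shows "2 ^ card S \<le> real_of_int D * sqrt (2 * exp 1 * (real (card S) + 1)) ^ m"
proof -
  let ?s = "real (card S)"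
  have finS: "finite S" using S finite_subset by blast
  \<comment> \<open>This choice minimises \<open>2 / sqrt l * exp (l * (?s + 1) / 4)\<close>, the
    factor that each coordinate finally contributes.\<close>
  define l where "l = 2 / (?s + 1)"
  have l: "l > 0" by (simp add: l_def add_nonneg_pos)
  define C where "C = 2 / sqrt l * exp (l / 4)"
  obtain h where h: "\<And>i j. i < m \<Longrightarrow> j < n \<Longrightarrow> \<bar>h i j\<bar> \<le> 1"
    and le: "(\<Sum>X\<in>Pow S. \<Prod>i<m. exp (- l * (\<Sum>j\<in>S. (if j \<in> X then 1/2 else -1/2) * h i j)\<^sup>2)) \<le> of_int D * C ^ m"
  proof -
    show thesis
      by (rule subset_sums_weight_bound[OF S inj exp_ge_zero sum_gaussian_le[OF _ l]];
          (blast | (rule that; simp add: C_def)))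
  qed
  define Q where "Q = (\<lambda>X. \<Sum>i<m. l * (\<Sum>j\<in>S. (if j \<in> X then 1/2 else -1/2) * h i j)\<^sup>2)"
  define q where "q = real m * (l * ?s / 4)"
  have "(\<Sum>X\<in>Pow S. Q X) = (\<Sum>i<m. l * (2 ^ card S * (\<Sum>j\<in>S. (h i j)\<^sup>2) / 4))"
    unfolding Q_def
    by (subst sum.swap) (simp only: sum_distrib_left[symmetric] sum_Pow_signed_sum_square[OF finS])
  also have "\<dots> \<le> (\<Sum>i<m. l * (2 ^ card S * ?s / 4))"
  proof (intro sum_mono mult_left_mono divide_right_mono)
    fix i assume i: "i \<in> {..<m}"
    have "(\<Sum>j\<in>S. (h i j)\<^sup>2) \<le> (\<Sum>j\<in>S. 1)"
      by (rule sum_mono) (use h i S in \<open>auto simp: abs_square_le_1\<close>)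
    then show "(\<Sum>j\<in>S. (h i j)\<^sup>2) \<le> ?s" by simp
  qed (use l in auto)
  also have "\<dots> = real (card (Pow S)) * q"
    using finS by (simp add: q_def card_Pow)
  finally have "real (card (Pow S)) * exp (- q) \<le> (\<Sum>X\<in>Pow S. exp (- Q X))"
    using finS by (intro jensen_exp_sum) auto
  also have "\<dots> \<le> of_int D * C ^ m"
    using le by (simp add: Q_def exp_sum sum_negf[symmetric])
  finally have "2 ^ card S * exp (- q) * exp q \<le> of_int D * C ^ m * exp q"
    using finS by (intro mult_right_mono) (auto simp: card_Pow)
  then have "2 ^ card S \<le> of_int D * C ^ m * exp q"
    by (simp add: mult.assoc flip: exp_add)
  also have "\<dots> = of_int D * (C * exp (l * ?s / 4)) ^ m"
    unfolding q_def exp_of_nat_mult power_mult_distrib by (simp only: mult.assoc)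
  also have "C * exp (l * ?s / 4) = sqrt (2 * exp 1 * (?s + 1))"
  proof -
    have "C * exp (l * ?s / 4) = 2 / sqrt l * exp (l * (?s + 1) / 4)"
      by (simp add: C_def exp_add[symmetric] algebra_simps add_divide_distrib)
    also have "l * (?s + 1) / 4 = 1 / 2" by (simp add: l_def field_simps add_nonneg_pos)
    finally have eq: "C * exp (l * ?s / 4) = 2 / sqrt l * exp (1 / 2)" .
    have "(exp (1 / 2 :: real))\<^sup>2 = exp 1" by (simp flip: exp_double)
    then have "(2 / sqrt l * exp (1 / 2))\<^sup>2 = 2 * exp 1 * (?s + 1)"
      using l by (simp add: power_mult_distrib power_divide) (simp add: l_def)
    moreover have "2 / sqrt l * exp (1 / 2) \<ge> 0" using l by simp
    ultimately show ?thesis using eq by (metis real_sqrt_unique)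
  qed
  finally show ?thesis .
qed

end

section \<open>Numerical bound on the support size\<close>

text \<open>Taking logarithms gives \<open>3 * log 2 (s + 1) \<le> 3 + s\<close>, which for
  \<open>m = 1\<close> turns the box bound into \<open>2 * s \<le> 3 * (1 + log 2 D)\<close>.
  Equality holds at \<open>s = 3\<close>.\<close>

lemma cube_le_exp2: "(real s + 1) ^ 3 \<le> 8 * 2 ^ s"
proof (cases "s < 3")
  case True
  then have "s = 0 \<or> s = 1 \<or> s = 2" by auto
  then show ?thesis by auto
next
  case False
  then have "s \<ge> 3" by simp
  then show ?thesis
  proof (induction s rule: dec_induct)
    case (step s)
    have "(real (Suc s) + 1) ^ 3 \<le> 2 * (real s + 1) ^ 3"
    proof -
      have s: "real s \<ge> 3" using step by simp
      have "2 * (real s + 1) ^ 3 - (real (Suc s) + 1) ^ 3 =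
          (real s - 3) * ((real s)\<^sup>2 + 3 * real s + 3) + 3"
        by (simp add: power3_eq_cube power2_eq_square algebra_simps)
      moreover have "\<dots> \<ge> 0" using s by (intro add_nonneg_nonneg mult_nonneg_nonneg) auto
      ultimately show ?thesis by linarith
    qed
    then show ?case using step.IH by simp
  qed simp
qed

text \<open>The Gaussian bound gives \<open>s \<le> 2 m L\<close>, where \<open>L\<close> is the logarithm, which suffices for \<open>m \<ge> 2\<close>;
  for \<open>m = 1\<close> it is slightly too weak, and the box bound is used instead.\<close>

lemma support_bound_arith:
  fixes m s :: nat and D :: real
  assumes m: "m \<ge> 1" and D: "D \<ge> 1"
    and box: "2 ^ s \<le> D * (real s + 1) ^ m"
    and gauss: "2 ^ s \<le> D * sqrt (2 * exp 1 * (real s + 1)) ^ m"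
  shows "real s * (real m + 1) \<le> 3 * real m ^ 2 * log 2 (2 * sqrt (real m) * D powr (1 / real m))"
proof -
  define L where "L = log 2 (2 * sqrt (real m) * D powr (1 / real m))"
  have L: "L = 1 + log 2 (real m) / 2 + log 2 D / real m"
  proof -
    have "real m > 0" "D > 0" using m D by auto
    then have "ln (2 * sqrt (real m) * D powr (1 / real m)) = ln 2 + ln (real m) / 2 + ln D / real m"
      by (simp add: ln_mult ln_sqrt ln_powr)
    then show ?thesis by (simp add: L_def log_def add_divide_distrib mult.commute)
  qed
  have logD: "log 2 D \<ge> 0" using D by simp
  have "real s * (real m + 1) \<le> 3 * real m ^ 2 * L"
  proof (cases "m = 1")
    case True
    have "log 2 (2 ^ s) \<le> log 2 (D * (real s + 1))"
      using box D True by (subst log_le_cancel_iff) auto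
    then have 1: "real s \<le> log 2 D + log 2 (real s + 1)"
      using D by (simp add: log_mult log_nat_power)
    have "log 2 ((real s + 1) ^ 3) \<le> log 2 (8 * 2 ^ s)"
      using cube_le_exp2[of s] by (subst log_le_cancel_iff) auto
    also have "\<dots> = 3 + real s"
    proof -
      have "log 2 (2 ^ (3 + s)) = real (3 + s)" by (rule log_pow_cancel) auto
      then show ?thesis by (simp add: power_add)
    qed
    finally have "3 * log 2 (real s + 1) \<le> 3 + real s" by (simp add: log_nat_power)
    then show ?thesis using 1 True L by simp
  next
    case False
    with m have m2: "m \<ge> 2" by simp
    have "real s \<le> 2 * real m * L"
    proof (rule ccontr)
      assume "\<not> ?thesis"
      then have gt: "real s > 2 * real m * L" by simp
      \<comment> \<open>Eliminating \<open>D\<close> and \<open>L\<close> from the Gaussian bound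
        leaves an upper bound for \<open>2 powr t\<close> that is linear in \<open>t\<close>, and
        such a bound is violated for all \<open>t > 2\<close>.\<close>
      define t where "t = real s / real m"
      have L1: "L \<ge> 1" using L logD m by simp
      have t2: "t > 2" 
      proof -
        have "2 * L < t" using gt m by (simp add: t_def field_simps)
        then show ?thesis using L1 by linarith
      qed
      have "log 2 (2 ^ s) \<le> log 2 (D * sqrt (2 * exp 1 * (real s + 1)) ^ m)"
        using gauss D by (subst log_le_cancel_iff) auto
      also have "\<dots> = log 2 D + real m * (log 2 (2 * exp 1 * (real s + 1)) / 2)"
      proof -
        have pos: "sqrt (2 * exp 1 * (real s + 1)) > 0" by simp
        then have "log 2 (D * sqrt (2 * exp 1 * (real s + 1)) ^ m) =
            log 2 D + real m * log 2 (sqrt (2 * exp 1 * (real s + 1)))"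
          using D by (subst log_mult) (auto simp: log_nat_power)
        then show ?thesis by (simp add: log_def ln_sqrt)
      qed
      finally have "2 * real s \<le> 2 * log 2 D + real m * log 2 (2 * exp 1 * (real s + 1))" by simp
      moreover have "2 * log 2 D = 2 * real m * L - 2 * real m - real m * log 2 (real m)"
        unfolding L using m by (simp add: field_simps)
      ultimately have "real s < real m * (log 2 (2 * exp 1 * (real s + 1)) - 2 - log 2 (real m))"
        using gt by (simp add: algebra_simps)
      then have "t < log 2 (2 * exp 1 * (real s + 1)) - 2 - log 2 (real m)"
        using m by (simp add: t_def field_simps)
      also have "\<dots> = log 2 (2 * exp 1 * (real s + 1) / (4 * real m))"
      proof -
        have "log 2 4 = (2::real)" using log_pow_cancel[of 2 2] by simp
        then show ?thesis using m by (simp add: log_divide log_mult)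
      qed
      finally have "2 powr t < 2 * exp 1 * (real s + 1) / (4 * real m)"
        using m by (subst (asm) less_log_iff) auto
      also have "\<dots> = exp 1 / 2 * (t + 1 / real m)" using m by (simp add: t_def field_simps)
      \<comment> \<open>For \<open>t > 2\<close> this line runs below the tangent of
        \<open>2 powr t\<close> at 2; the estimates \<open>exp 1 < 2.72\<close> and
        \<open>ln 2 \<ge> 2/3\<close> are sharp enough to show it.\<close>
      also have "\<dots> \<le> 272 / 200 * (t + 1 / 2)"
        using m2 t2 e_less_272 by (intro mult_mono add_left_mono) (auto simp: field_simps)
      also have "\<dots> \<le> 4 * (1 + (t - 2) * (2 / 3))" using t2 by (simp add: field_simps)
      also have "\<dots> \<le> 4 * (1 + (t - 2) * ln 2)"
        using t2 ln2_ge_two_thirds by (intro mult_left_mono add_left_mono) auto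
      also have "\<dots> \<le> 4 * exp ((t - 2) * ln 2)"
        by (intro mult_left_mono exp_ge_add_one_self) auto
      also have "\<dots> = 2 powr t"
      proof -
        have "(2::real) powr (t - 2) = exp ((t - 2) * ln 2)" by (simp add: powr_def)
        then show ?thesis using powr_diff[of 2 t 2] by simp
      qed
      finally show False by simp
    qed
    then have "real s * (real m + 1) \<le> 2 * real m * L * (real m + 1)"
      by (intro mult_right_mono) auto
    also have "\<dots> = L * (2 * real m * (real m + 1))" by simp
    also have "\<dots> \<le> L * (3 * real m ^ 2)"
    proof (rule mult_left_mono)
      show "2 * real m * (real m + 1) \<le> 3 * real m ^ 2"
        using m2 by (simp add: power2_eq_square algebra_simps)
      show "L \<ge> 0" using L logD m by simp
    qed
    finally show ?thesis by (simp add: mult.commute)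
  qed
  then show ?thesis by (simp add: L_def)
qed

section \<open>Integer and linear programs\<close>

lemma carrier_vec_eq_iff:
  assumes "v \<in> carrier_vec m" "w \<in> carrier_vec m"
  shows "v = w \<longleftrightarrow> (\<forall>i<m. vec_index v i = vec_index w i)"
  using assms by (auto intro: eq_vecI)

lemma ip_feasible_iff:
  fixes A :: "int mat" and b z :: "int vec"
  assumes A: "A \<in> carrier_mat m n" and b: "b \<in> carrier_vec m"
  shows "ip_feasible A b z \<longleftrightarrow> z \<in> carrier_vec n \<and>
    (\<forall>i<m. (\<Sum>j<n. A $$ (i, j) * z $ j) = b $ i) \<and> (\<forall>j<n. z $ j \<ge> 0)"
proof -
  have "A *\<^sub>v z = b \<longleftrightarrow> (\<forall>i<m. (\<Sum>j<n. A $$ (i, j) * z $ j) = b $ i)" if z: "z \<in> carrier_vec n"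
  proof -
    have "A *\<^sub>v z \<in> carrier_vec m" using A by (rule mult_mat_vec_carrier) (rule z)
    moreover have "(A *\<^sub>v z) $ i = (\<Sum>j<n. A $$ (i, j) * z $ j)" if "i < m" for i
      using A z that by (simp add: scalar_prod_def lessThan_atLeast0)
    ultimately show ?thesis using carrier_vec_eq_iff[OF _ b] by simp
  qed
  then show ?thesis unfolding ip_feasible_def using A by (cases "z \<in> carrier_vec n") simp_all
qed

lemma lp_feasible_iff:
  fixes A :: "int mat" and b :: "int vec" and x :: "real vec"
  assumes A: "A \<in> carrier_mat m n" and b: "b \<in> carrier_vec m"
  shows "lp_feasible A b x \<longleftrightarrow> x \<in> carrier_vec n \<and>
    (\<forall>i<m. (\<Sum>j<n. real_of_int (A $$ (i, j)) * x $ j) = of_int (b $ i)) \<and> (\<forall>j<n. x $ j \<ge> 0)"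
proof -
  let ?A = "map_mat real_of_int A" and ?b = "map_vec real_of_int b"
  have "?A *\<^sub>v x = ?b \<longleftrightarrow> (\<forall>i<m. (\<Sum>j<n. real_of_int (A $$ (i, j)) * x $ j) = of_int (b $ i))"
    if x: "x \<in> carrier_vec n"
  proof -
    have "?A *\<^sub>v x \<in> carrier_vec m" "?b \<in> carrier_vec m"
      using A b x by (auto intro: mult_mat_vec_carrier)
    moreover have "(?A *\<^sub>v x) $ i = (\<Sum>j<n. real_of_int (A $$ (i, j)) * x $ j)" if "i < m" for i
      using A x that by (simp add: scalar_prod_def lessThan_atLeast0)
    moreover have "?b $ i = of_int (b $ i)" if "i < m" for i using b that by simp
    ultimately show ?thesis using carrier_vec_eq_iff[of "?A *\<^sub>v x" m ?b] by simp
  qed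
  then show ?thesis unfolding lp_feasible_def using A by (cases "x \<in> carrier_vec n") simp_all
qed

text \<open>The objective takes integer values bounded by \<open>M\<close>, so the gap to
  \<open>M\<close> is a natural number and attains its minimum.\<close>

lemma ip_optimum_exists:
  assumes "\<exists>z. ip_feasible A b z" "ip_bounded A b c"
  shows "\<exists>z. ip_optimal A b c z"
proof -
  obtain z0 where z0: "ip_feasible A b z0" using assms(1) by blast
  obtain M where M: "\<And>z. ip_feasible A b z \<Longrightarrow> c \<bullet> z \<le> M"
    using assms(2) by (auto simp: ip_bounded_def)
  obtain z where z: "ip_feasible A b z"
    and least: "\<And>w. ip_feasible A b w \<Longrightarrow> nat (M - c \<bullet> z) \<le> nat (M - c \<bullet> w)"
    using ex_has_least_nat[of "ip_feasible A b" z0 "\<lambda>z. nat (M - c \<bullet> z)"] z0 by blast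
  have "c \<bullet> w \<le> c \<bullet> z" if "ip_feasible A b w" for w
    using least[OF that] M[OF that] M[OF z] by linarith
  then show ?thesis using z by (auto simp: ip_optimal_def)
qed

text \<open>If two sets of columns in the support had the same sum, the difference of their indicator
  vectors could be added to or subtracted from the optimum without loss until a coordinate vanishes.\<close>

lemma ip_optimum_distinct_subset_sums:
  fixes A :: "int mat" and b c :: "int vec"
  assumes A: "A \<in> carrier_mat m n" and b: "b \<in> carrier_vec m" and c: "c \<in> carrier_vec n"
    and "\<exists>z. ip_feasible A b z" "ip_bounded A b c"
  obtains z :: "int vec" where "ip_optimal A b c z"
    and "\<And>X Y. X \<subseteq> {j. j < n \<and> z $ j \<noteq> 0} \<Longrightarrow> Y \<subseteq> {j. j < n \<and> z $ j \<noteq> 0} \<Longrightarrow>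
      (\<And>i. i < m \<Longrightarrow> (\<Sum>j\<in>X. A $$ (i, j)) = (\<Sum>j\<in>Y. A $$ (i, j))) \<Longrightarrow> X = Y"
proof -
  obtain z where opt: "ip_optimal A b c z"
    and min: "\<And>w. ip_optimal A b c w \<Longrightarrow> card {j. j < n \<and> z $ j \<noteq> 0} \<le> card {j. j < n \<and> w $ j \<noteq> 0}"
    using ip_optimum_exists[OF assms(4,5)]
      ex_has_least_nat[of "ip_optimal A b c" _ "\<lambda>z. card {j. j < n \<and> z $ j \<noteq> 0}"] by blast
  let ?S = "{j. j < n \<and> z $ j \<noteq> 0}"
  have z: "z \<in> carrier_vec n" "\<And>i. i < m \<Longrightarrow> (\<Sum>j<n. A $$ (i, j) * z $ j) = b $ i" "\<And>j. j < n \<Longrightarrow> z $ j \<ge> 0"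
    using opt unfolding ip_optimal_def ip_feasible_iff[OF A b] by auto
  have sub: "Y \<subseteq> X" if X: "X \<subseteq> ?S" and Y: "Y \<subseteq> ?S"
    and eq: "\<And>i. i < m \<Longrightarrow> (\<Sum>j\<in>X. A $$ (i, j)) = (\<Sum>j\<in>Y. A $$ (i, j))" for X Y
  proof (rule ccontr)
    assume "\<not> Y \<subseteq> X"
    then have ne: "Y - X \<noteq> {}" by blast
    have finY: "finite Y" using Y by (rule finite_subset) simp
    obtain k where k: "k \<in> Y - X" and kmin: "\<And>j. j \<in> Y - X \<Longrightarrow> z $ k \<le> z $ j"
      by (rule finite_nonempty_minimizer[of "Y - X" "\<lambda>j. z $ j"]) (use finY ne in auto)
    define y :: "nat \<Rightarrow> int" where "y = (\<lambda>j. (if j \<in> X then 1 else 0) - (if j \<in> Y then 1 else 0))"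
    have sumy: "(\<Sum>j<n. g j * y j) = (\<Sum>j\<in>X. g j) - (\<Sum>j\<in>Y. g j)" for g :: "nat \<Rightarrow> int"
    proof -
      have "(\<Sum>j<n. g j * y j) = (\<Sum>j<n. if j \<in> X then g j else 0) - (\<Sum>j<n. if j \<in> Y then g j else 0)"
        unfolding sum_subtractf[symmetric] by (intro sum.cong) (auto simp: y_def)
      moreover have "{..<n} \<inter> X = X" "{..<n} \<inter> Y = Y" using X Y by auto
      ultimately show ?thesis by (simp flip: sum.inter_restrict)
    qed
    define w where "w = (\<lambda>t. Matrix.vec n (\<lambda>j. z $ j + t * y j))"
    have feas: "ip_feasible A b (w t)" if "\<And>j. j < n \<Longrightarrow> z $ j + t * y j \<ge> 0" for t
    proof -
      have "(\<Sum>j<n. A $$ (i, j) * (z $ j + t * y j)) = b $ i" if "i < m" for i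
      proof -
        have "(\<Sum>j<n. A $$ (i, j) * (z $ j + t * y j)) =
            (\<Sum>j<n. A $$ (i, j) * z $ j) + t * (\<Sum>j<n. A $$ (i, j) * y j)"
          by (simp add: algebra_simps sum.distrib sum_distrib_left)
        then show ?thesis using z(2)[OF that] eq[OF that] by (simp add: sumy)
      qed
      then show ?thesis using that unfolding ip_feasible_iff[OF A b] by (simp add: w_def)
    qed
    have obj: "c \<bullet> w t = c \<bullet> z + t * (\<Sum>j<n. c $ j * y j)" for t
    proof -
      have "c \<bullet> w t = (\<Sum>j<n. c $ j * (z $ j + t * y j))"
        by (simp add: scalar_prod_def w_def lessThan_atLeast0)
      also have "\<dots> = (\<Sum>j<n. c $ j * z $ j) + t * (\<Sum>j<n. c $ j * y j)"
        by (simp add: algebra_simps sum.distrib sum_distrib_left)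
      finally show ?thesis using z(1) by (simp add: scalar_prod_def lessThan_atLeast0)
    qed
    have zpos: "z $ j \<ge> 1" if "j \<in> ?S" for j using that z(3)[of j] by auto
    \<comment> \<open>As \<open>z\<close> is at least 1 on its support, one step against
      \<open>y\<close> is feasible. Optimality of \<open>z\<close> then shows that \<open>y\<close>
      does not lower the objective.\<close>
    have "ip_feasible A b (w (-1))"
    proof (rule feas)
      fix j assume "j < n"
      then show "z $ j + - 1 * y j \<ge> 0"
        using z(3)[of j] zpos[of j] X by (cases "j \<in> X"; cases "j \<in> Y") (auto simp: y_def)
    qed
    then have "c \<bullet> w (-1) \<le> c \<bullet> z" using opt by (simp add: ip_optimal_def)
    then have cy: "(\<Sum>j<n. c $ j * y j) \<ge> 0" by (simp add: obj)
    have zk: "z $ k \<ge> 1" using k Y by (intro zpos) auto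
    \<comment> \<open>Along \<open>y\<close> only the coordinates in \<open>Y - X\<close> decrease.
      The step \<open>z $ k\<close>, the least entry among them, keeps all coordinates nonnegative
      and clears coordinate \<open>k\<close>.\<close>
    have feas_w: "ip_feasible A b (w (z $ k))"
    proof (rule feas)
      fix j assume "j < n"
      then show "z $ j + z $ k * y j \<ge> 0"
        using z(3)[of j] zk kmin[of j] by (cases "j \<in> X"; cases "j \<in> Y") (auto simp: y_def)
    qed
    have "c \<bullet> w (z $ k) \<ge> c \<bullet> z" using cy zk by (simp add: obj)
    then have "ip_optimal A b c (w (z $ k))"
      using opt feas_w unfolding ip_optimal_def by (meson order_trans)
    then have "card ?S \<le> card {j. j < n \<and> w (z $ k) $ j \<noteq> 0}" by (rule min)
    moreover have "{j. j < n \<and> w (z $ k) $ j \<noteq> 0} \<subset> ?S"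
    proof -
      have "w (z $ k) $ k = 0" "k \<in> ?S" using k Y by (auto simp: w_def y_def)
      moreover have "w (z $ k) $ j = 0" if "j < n" "z $ j = 0" for j
        using that X Y by (auto simp: w_def y_def)
      ultimately show ?thesis by blast
    qed
    ultimately show False using psubset_card_mono[of ?S] by (simp add: not_less[symmetric])
  qed
  show thesis
    by (rule that[OF opt]) (intro equalityI; rule sub; simp)
qed

text \<open>A nonzero kernel vector on the support of \<open>x\<close> could be added and subtracted
  with a small factor \<open>e\<close>, making \<open>x\<close> the midpoint of two distinct
  feasible points.\<close>

lemma lp_vertex_independent_support:
  fixes A :: "int mat" and b :: "int vec" and x :: "real vec" and v :: "nat \<Rightarrow> real"
  assumes A: "A \<in> carrier_mat m n" and b: "b \<in> carrier_vec m" and x: "lp_vertex A b x"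
    and v: "\<And>i. i < m \<Longrightarrow> (\<Sum>j<n. real_of_int (A $$ (i, j)) * v j) = 0"
    and supp: "\<And>j. j < n \<Longrightarrow> v j \<noteq> 0 \<Longrightarrow> x $ j \<noteq> 0"
    and j: "j < n"
  shows "v j = 0"
proof (rule ccontr)
  assume vj: "v j \<noteq> 0"
  have feas: "lp_feasible A b x" using x by (simp add: lp_vertex_def)
  then have xs: "x \<in> carrier_vec n" "\<And>i. i < m \<Longrightarrow> (\<Sum>j<n. real_of_int (A $$ (i, j)) * x $ j) = of_int (b $ i)"
    "\<And>j. j < n \<Longrightarrow> x $ j \<ge> 0" unfolding lp_feasible_iff[OF A b] by auto
  obtain k where k: "k < n" "v k \<noteq> 0" and kmin: "\<And>l. l < n \<Longrightarrow> v l \<noteq> 0 \<Longrightarrow> x $ k / \<bar>v k\<bar> \<le> x $ l / \<bar>v l\<bar>"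
    by (rule finite_nonempty_minimizer[of "{l. l < n \<and> v l \<noteq> 0}" "\<lambda>l. x $ l / \<bar>v l\<bar>"])
       (use j vj in auto)
  define e where "e = x $ k / \<bar>v k\<bar>"
  have e: "e > 0" using k supp[OF k] xs(3)[OF k(1)] by (simp add: e_def)
  have le: "e * \<bar>v l\<bar> \<le> x $ l" if "l < n" for l
    using kmin[OF that] xs(3)[OF that] by (cases "v l = 0") (auto simp: e_def field_simps)
  define y where "y = (\<lambda>t. Matrix.vec n (\<lambda>l. x $ l + t * v l))"
  have feas_y: "lp_feasible A b (y t)" if "\<bar>t\<bar> = e" for t
  proof -
    have "(\<Sum>l<n. real_of_int (A $$ (i, l)) * (x $ l + t * v l)) = of_int (b $ i)" if "i < m" for i
    proof -
      have "(\<Sum>l<n. real_of_int (A $$ (i, l)) * (x $ l + t * v l)) =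
          (\<Sum>l<n. real_of_int (A $$ (i, l)) * x $ l) + t * (\<Sum>l<n. real_of_int (A $$ (i, l)) * v l)"
        by (simp add: algebra_simps sum.distrib sum_distrib_left)
      then show ?thesis using xs(2)[OF that] v[OF that] by simp
    qed
    moreover have "x $ l + t * v l \<ge> 0" if "l < n" for l
    proof -
      have "\<bar>t * v l\<bar> \<le> x $ l" using le[OF that] \<open>\<bar>t\<bar> = e\<close> by (simp add: abs_mult)
      then show ?thesis by linarith
    qed
    ultimately show ?thesis unfolding lp_feasible_iff[OF A b] by (simp add: y_def)
  qed
  have "y e \<noteq> y (- e)"
  proof
    assume "y e = y (- e)"
    then have "y e $ j = y (- e) $ j" by simp
    then show False using j e vj by (simp add: y_def)
  qed
  moreover have "x = (1/2) \<cdot>\<^sub>v y e + (1 - 1/2) \<cdot>\<^sub>v y (- e)"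
    using xs(1) by (intro eq_vecI) (auto simp: y_def field_simps)
  moreover have "lp_feasible A b (y e)" "lp_feasible A b (y (- e))" using e by (auto intro: feas_y)
  ultimately have "\<exists>y w t. lp_feasible A b y \<and> lp_feasible A b w \<and> y \<noteq> w \<and> 0 < t \<and> t < 1 \<and>
      x = t \<cdot>\<^sub>v y + (1 - t) \<cdot>\<^sub>v w"
    by (intro exI[of _ "y e"] exI[of _ "y (- e)"] exI[of _ "1/2"] conjI) auto
  then show False using x unfolding lp_vertex_def by blast
qed

theorem theorem1:
  fixes A :: "int mat" and b c :: "int vec" and m n :: nat and xs :: "real vec"
  assumes "A \<in> carrier_mat m n" and "b \<in> carrier_vec m" and "c \<in> carrier_vec n"
    and "m \<ge> 1"
    and "vec_space.rank m (map_mat real_of_int A) = m"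
    and "\<exists>z. ip_feasible A b z"
    and "ip_bounded A b c"
    and "lp_vertex A b xs" and "lp_optimal A b c xs"
  shows "\<exists>zs. ip_optimal A b c zs \<and>
     l1_dist zs xs < 3 * real m ^ 2 *
        log 2 (2 * sqrt (real m) * real_of_int (Delta A) powr (1 / real m)) * real_of_int (Delta A)"
proof -
  note A = assms(1) and b = assms(2) and c = assms(3)
  let ?a = "\<lambda>i j. A $$ (i, j)"
  let ?L = "log 2 (2 * sqrt (real m) * real_of_int (Delta A) powr (1 / real m))"
  obtain f where f: "\<And>k. k < m \<Longrightarrow> f k < n" "minor m ?a f \<noteq> 0"
    using full_rank_nonzero_minor[OF A assms(5)] by blast
  have inj: "inj_on f {..<m}" using f(2) minor_eq_0 by blast
  have "Delta A \<ge> \<bar>minor m ?a f\<bar>" using abs_minor_le_Delta[OF A f(1) inj] .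
  then have Delta1: "Delta A \<ge> 1" using f(2) by linarith
  have "m \<le> n" using card_inj_on_le[OF inj, of "{..<n}"] f(1) by auto
  then obtain f0 where f0: "\<And>k. k < m \<Longrightarrow> f0 k < n" "\<bar>minor m ?a f0\<bar> = Delta A"
    using Delta_attained[OF A] by blast
  interpret full_rank_matrix m n ?a "Delta A"
  proof
    show "\<bar>minor m ?a f\<bar> \<le> Delta A" if "\<And>k. k < m \<Longrightarrow> f k < n" for f
      using abs_minor_le_Delta[OF A that] minor_eq_0[of f m ?a] Delta1
      by (cases "inj_on f {..<m}") auto
    show "\<exists>f. (\<forall>k<m. f k < n) \<and> minor m ?a f \<noteq> 0 \<and> \<bar>minor m ?a f\<bar> = Delta A"
      using f0 Delta1 by (intro exI[of _ f0]) auto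
  qed
  obtain z where opt: "ip_optimal A b c z"
    and distinct: "\<And>X Y. X \<subseteq> {j. j < n \<and> z $ j \<noteq> 0} \<Longrightarrow> Y \<subseteq> {j. j < n \<and> z $ j \<noteq> 0} \<Longrightarrow>
      (\<And>i. i < m \<Longrightarrow> (\<Sum>j\<in>X. A $$ (i, j)) = (\<Sum>j\<in>Y. A $$ (i, j))) \<Longrightarrow> X = Y"
    using ip_optimum_distinct_subset_sums[OF A b c assms(6,7)] by blast
  define S where "S = {j. j < n \<and> z $ j \<noteq> 0}"
  have S: "S \<subseteq> {..<n}" "finite S" by (auto simp: S_def)
  have bound: "real (card S) * (real m + 1) \<le> 3 * real m ^ 2 * ?L"
    using distinct_subset_sums_box_bound[OF S(1)] distinct_subset_sums_gaussian_bound[OF S(1)]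
      distinct assms(4) Delta1
    by (intro support_bound_arith) (auto simp: S_def)
  have z: "z \<in> carrier_vec n" "\<And>i. i < m \<Longrightarrow> (\<Sum>j<n. A $$ (i, j) * z $ j) = b $ i" "\<And>j. j < n \<Longrightarrow> z $ j \<ge> 0"
    using opt unfolding ip_optimal_def ip_feasible_iff[OF A b] by auto
  have x: "xs \<in> carrier_vec n" "\<And>i. i < m \<Longrightarrow> (\<Sum>j<n. real_of_int (A $$ (i, j)) * xs $ j) = of_int (b $ i)"
    "\<And>j. j < n \<Longrightarrow> xs $ j \<ge> 0"
    using assms(9) unfolding lp_optimal_def lp_feasible_iff[OF A b] by auto
  define d where "d = (\<lambda>j. if j < n then xs $ j - of_int (z $ j) else 0)"
  have ker_d: "in_ker d"
  proof -
    have "(\<Sum>j<n. real_of_int (A $$ (i, j)) * d j) = 0" if "i < m" for i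
    proof -
      have "(\<Sum>j<n. real_of_int (A $$ (i, j)) * d j) =
          (\<Sum>j<n. real_of_int (A $$ (i, j)) * xs $ j) - of_int (\<Sum>j<n. A $$ (i, j) * z $ j)"
        by (simp add: d_def algebra_simps sum_subtractf)
      then show ?thesis using x(2)[OF that] z(2)[OF that] by simp
    qed
    then show ?thesis by (simp add: in_ker_def d_def)
  qed
  \<comment> \<open>A kernel vector supported on the support of \<open>d\<close> that vanishes at
    these coordinates lives on the support of the vertex \<open>xs\<close>, where the columns are
    independent. At most \<open>card S\<close> evaluations therefore certify the dimension.\<close>
  define \<Phi> :: "((nat \<Rightarrow> real) \<Rightarrow> real) set" where "\<Phi> = (\<lambda>j v. v j) ` {j \<in> S. xs $ j = 0}"
  have "card \<Phi> \<le> card {j \<in> S. xs $ j = 0}" unfolding \<Phi>_def using S by (intro card_image_le) auto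
  also have "\<dots> \<le> card S" using S by (intro card_mono) auto
  finally have card\<Phi>: "card \<Phi> \<le> card S" .
  have sep: "v = (\<lambda>_. 0)"
    if v: "in_ker v" "\<And>j. d j = 0 \<Longrightarrow> v j = 0" "\<And>\<phi>. \<phi> \<in> \<Phi> \<Longrightarrow> \<phi> v = 0" for v
  proof
    fix j
    have supp: "xs $ j \<noteq> 0" if "j < n" "v j \<noteq> 0" for j
    proof
      assume "xs $ j = 0"
      moreover have "z $ j \<noteq> 0" using v(2)[of j] that \<open>xs $ j = 0\<close> by (auto simp: d_def)
      ultimately have "(\<lambda>v. v j) \<in> \<Phi>" using that by (auto simp: \<Phi>_def S_def)
      then show False using v(3) that by blast
    qed
    show "v j = 0"
    proof (cases "j < n")
      case True
      show ?thesis
        by (rule lp_vertex_independent_support[OF A b assms(8) _ supp True])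
           (use v(1) in \<open>auto simp: in_ker_def\<close>)
    next
      case False
      then show ?thesis using v(1) by (simp add: in_ker_def)
    qed
  qed
  have fin\<Phi>: "finite \<Phi>" using S by (simp add: \<Phi>_def)
  have lin\<Phi>: "\<phi> (\<lambda>j. v j - c * w j) = \<phi> v - c * \<phi> w" if "\<phi> \<in> \<Phi>" for \<phi> v w c
    using that by (auto simp: \<Phi>_def)
  let ?rounding = "\<lambda>u :: nat \<Rightarrow> int. in_ker (\<lambda>j. of_int (u j)) \<and>
    (\<forall>j. 0 \<le> real_of_int (u j) \<and> of_int (u j) \<le> d j \<or> d j \<le> of_int (u j) \<and> real_of_int (u j) \<le> 0) \<and>
    (\<Sum>j<n. \<bar>d j - of_int (u j)\<bar>) \<le> real (card S) * ((real m + 1) * of_int (Delta A)) \<and>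
    (card S > 0 \<longrightarrow> (\<Sum>j<n. \<bar>d j - of_int (u j)\<bar>) < real (card S) * ((real m + 1) * of_int (Delta A)))"
  have "\<exists>u. ?rounding u"
    by (rule conformal_rounding[OF ker_d fin\<Phi> card\<Phi> lin\<Phi> sep]; blast)
  then obtain u where u: "?rounding u" ..
  from u have ker_u: "in_ker (\<lambda>j. of_int (u j))" by (rule conjunct1)
  from u have conf: "0 \<le> real_of_int (u j) \<and> of_int (u j) \<le> d j \<or> d j \<le> of_int (u j) \<and> real_of_int (u j) \<le> 0" for j
    by simp
  from u have le: "(\<Sum>j<n. \<bar>d j - of_int (u j)\<bar>) \<le> real (card S) * ((real m + 1) * of_int (Delta A))"
    and less: "card S > 0 \<Longrightarrow> (\<Sum>j<n. \<bar>d j - of_int (u j)\<bar>) < real (card S) * ((real m + 1) * of_int (Delta A))"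
    by simp_all
  define zs where "zs = Matrix.vec n (\<lambda>j. z $ j + u j)"
  have Au: "(\<Sum>j<n. A $$ (i, j) * u j) = 0" if "i < m" for i
  proof -
    have "real_of_int (\<Sum>j<n. A $$ (i, j) * u j) = 0"
      using ker_u that by (simp add: in_ker_def)
    then show ?thesis by (simp only: of_int_eq_0_iff)
  qed
  \<comment> \<open>By conformality \<open>z + u\<close> lies coordinatewise between the nonnegative
    vectors \<open>z\<close> and \<open>xs\<close>.\<close>
  have "ip_feasible A b zs"
  proof -
    have "(\<Sum>j<n. A $$ (i, j) * (z $ j + u j)) = b $ i" if "i < m" for i
      using z(2)[OF that] Au[OF that] by (simp add: algebra_simps sum.distrib)
    moreover have "z $ j + u j \<ge> 0" if "j < n" for j
    proof -
      have "real_of_int (z $ j + u j) \<ge> 0"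
        using conf[of j] x(3)[OF that] z(3)[OF that] that by (auto simp: d_def)
      then show ?thesis by (simp only: of_int_0_le_iff)
    qed
    ultimately show ?thesis unfolding ip_feasible_iff[OF A b] by (simp add: zs_def)
  qed
  moreover have "c \<bullet> zs \<ge> c \<bullet> z"
  proof -
    \<comment> \<open>The opposite move \<open>xs - u\<close> also stays between \<open>z\<close>
      and \<open>xs\<close>, so it is feasible for the relaxation; optimality of \<open>xs\<close>
      shows that \<open>u\<close> does not lower the objective.\<close>
    define y where "y = Matrix.vec n (\<lambda>j. xs $ j - of_int (u j))"
    have "lp_feasible A b y"
    proof -
      have "(\<Sum>j<n. real_of_int (A $$ (i, j)) * (xs $ j - of_int (u j))) = of_int (b $ i)" if "i < m" for i
        using x(2)[OF that] ker_u that by (simp add: algebra_simps sum_subtractf in_ker_def)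
      moreover have "xs $ j - of_int (u j) \<ge> 0" if "j < n" for j
        using conf[of j] x(3)[OF that] z(3)[OF that] that by (auto simp: d_def)
      ultimately show ?thesis unfolding lp_feasible_iff[OF A b] by (simp add: y_def)
    qed
    then have "map_vec real_of_int c \<bullet> y \<le> map_vec real_of_int c \<bullet> xs"
      using assms(9) by (simp add: lp_optimal_def)
    moreover have "map_vec real_of_int c \<bullet> y = map_vec real_of_int c \<bullet> xs - of_int (\<Sum>j<n. c $ j * u j)"
      using x(1) c by (simp add: scalar_prod_def y_def algebra_simps sum_subtractf lessThan_atLeast0)
    ultimately have "real_of_int (\<Sum>j<n. c $ j * u j) \<ge> 0" by linarith
    then have "(\<Sum>j<n. c $ j * u j) \<ge> 0" by (simp only: of_int_0_le_iff)
    moreover have "c \<bullet> zs = c \<bullet> z + (\<Sum>j<n. c $ j * u j)"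
      using z(1) by (simp add: scalar_prod_def zs_def algebra_simps sum.distrib lessThan_atLeast0)
    ultimately show ?thesis by simp
  qed
  ultimately have "ip_optimal A b c zs"
    using opt unfolding ip_optimal_def by (meson order_trans)
  moreover have "l1_dist zs xs = (\<Sum>j<n. \<bar>d j - of_int (u j)\<bar>)"
    unfolding l1_dist_def using x(1)
    by (intro sum.cong) (auto simp: zs_def d_def abs_if)
  moreover have "(\<Sum>j<n. \<bar>d j - of_int (u j)\<bar>) < 3 * real m ^ 2 * ?L * real_of_int (Delta A)"
  proof (cases "card S = 0")
    case True
    \<comment> \<open>With empty support the distance is 0, and strictness has to come from the
      right-hand side being positive.\<close>
    have "real_of_int (Delta A) powr (1 / real m) \<ge> 1" using Delta1 by (intro ge_one_powr_ge_zero) auto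
    then have "2 * sqrt (real m) * real_of_int (Delta A) powr (1 / real m) \<ge> 2 * 1 * 1"
      using assms(4) by (intro mult_mono) auto
    then have "?L > 0" by simp
    then have "3 * real m ^ 2 * ?L * real_of_int (Delta A) > 0" using assms(4) Delta1 by simp
    moreover have "(\<Sum>j<n. \<bar>d j - of_int (u j)\<bar>) \<le> 0" using le True by simp
    ultimately show ?thesis by linarith
  next
    case False
    then have "(\<Sum>j<n. \<bar>d j - of_int (u j)\<bar>) < real (card S) * (real m + 1) * of_int (Delta A)"
      using less by (simp add: mult.assoc)
    also have "\<dots> \<le> 3 * real m ^ 2 * ?L * of_int (Delta A)"
      using bound Delta1 by (intro mult_right_mono) auto
    finally show ?thesis .
  qed
  ultimately show ?thesis by auto
qed

end
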